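(* Let $\tau\in(0,(1+\sqrt5)/2)$. Suppose that the solution set $\overline\Omega$ of the KKT system is nonempty and that the following error bound condition holds: for any given $\bar u\in\overline\Omega$ there exist constants $\delta>0$ and $\eta>0$ such that $$\mathrm{dist}(u,\overline\Omega)\le \eta\|R(u)\|\quad\text{for all } u\in\mathcal U \text{ with } \|u-\bar u\|\le\delta .$$ Assume also that both $\Sigma_{\vartheta_g}+\mathcal S+\sigma\mathcal A\mathcal A^*$ and $\Sigma_{\varphi_h}+\mathcal T+\sigma\mathcal B\mathcal B^*$ are positive definite. Let $\{u^k=(y^k,z^k,x^k)\}$ be the infinite sequence generated by the sPADMM (under these assumptions it converges to a point of $\overline\Omega$; let $\eta$ denote an error bound constant at this limit point). Then for all $k$ sufficiently large, $$\mathrm{dist}^2_{\mathcal M}(u^{k+1},\overline\Omega)+\|z^{k+1}-z^k\|^2_{\mathcal T}\le \mu\left[\mathrm{dist}^2_{\mathcal M}(u^{k},\overline\Omega)+\|z^{k}-z^{k-1}\|^2_{\mathcal T}\right],$$ where $$\mu:=(1+2\kappa_4)^{-1}(1+\kappa_4)<1,\qquad \kappa_4:=\min\{\tau,4t_\tau\}\left(\eta^2\kappa\,\lambda_{\max}(\mathcal M)\right)^{-1}>0 .$$ Moreover, there exists a number $\varsigma\in[\mu,1)$ such that for all $k\ge1$, $$\mathrm{dist}^2_{\mathcal M}(u^{k+1},\overline\Omega)+\|z^{k+1}-z^k\|^2_{\mathcal T}\le \varsigma\left[\mathrm{dist}^2_{\mathcal M}(u^{k},\overline\Omega)+\|z^{k}-z^{k-1}\|^2_{\mathcal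 T}\right].$$
   Context: $\mathcal X,\mathcal Y,\mathcal Z$ are finite-dimensional real Euclidean spaces, $\mathcal U:=\mathcal Y\times\mathcal Z\times\mathcal X$. $\vartheta:\mathcal Y\to(-\infty,+\infty]$, $\varphi:\mathcal Z\to(-\infty,+\infty]$ are proper closed convex functions, $g:\mathcal Y\to\mathbb R$, $h:\mathcal Z\to\mathbb R$ are continuously differentiable convex functions, $\mathcal A:\mathcal X\to\mathcal Y$, $\mathcal B:\mathcal X\to\mathcal Z$ are linear with adjoints $\mathcal A^*,\mathcal B^*$, and $c\in\mathcal X$. Put $\vartheta_g=\vartheta+g$, $\varphi_h=\varphi+h$. The problem is $$\min\{\vartheta(y)+g(y)+\varphi(z)+h(z):\ \mathcal A^*y+\mathcal B^*z=c,\ y\in\mathcal Y,\ z\in\mathcal Z\}.$$ $\overline\Omega$ is the set of $(y,z,x)\in\mathcal U$ with $0\in\partial\vartheta(y)+\nabla g(y)+\mathcal Ax$, $0\in\partial\varphi(z)+\nabla h(z)+\mathcal Bx$, $c-\mathcal A^*y-\mathcal B^*z=0$ (the KKT system). With $\mathrm{Pr}_\theta$ the Moreau–Yosida proximal mapping of $\theta$ ($\mathrm{Pr}_\theta(v)=\arg\min_w\{\theta(w)+\frac12\|w-v\|^2\}$), the KKT mapping $R:\mathcal U\to\mathcal U$ is $$R(u)=\big(y-\mathrm{Pr}_\vartheta[y-(\nabla g(y)+\mathcal Ax)],\ z-\mathrm{Pr}_\varphi[z-(\nabla h(z)+\mathcal Bx)],\ c-\mathcal A^*y-\mathcal B^*z\big),\quad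 u=(y,z,x).$$ sPADMM: let $\sigma>0$, $\tau>0$, and let $\mathcal S:\mathcal Y\to\mathcal Y$, $\mathcal T:\mathcal Z\to\mathcal Z$ be self-adjoint positive semi-definite linear operators. With $\mathcal L_\sigma(y,z;x)=\vartheta_g(y)+\varphi_h(z)+\langle x,\mathcal A^*y+\mathcal B^*z-c\rangle+\frac\sigma2\|\mathcal A^*y+\mathcal B^*z-c\|^2$ and $(y^0,z^0,x^0)\in\mathrm{dom}\,\vartheta\times\mathrm{dom}\,\varphi\times\mathcal X$, for $k=0,1,\dots$: $y^{k+1}\in\arg\min_y\mathcal L_\sigma(y,z^k;x^k)+\frac12\|y-y^k\|_{\mathcal S}^2$; $z^{k+1}\in\arg\min_z\mathcal L_\sigma(y^{k+1},z;x^k)+\frac12\|z-z^k\|_{\mathcal T}^2$; $x^{k+1}=x^k+\tau\sigma(\mathcal A^*y^{k+1}+\mathcal B^*z^{k+1}-c)$. For a self-adjoint positive semi-definite $\mathcal N$: $\|v\|_{\mathcal N}=\sqrt{\langle v,\mathcal Nv\rangle}$, $\mathrm{dist}_{\mathcal N}(v,C)=\inf_{v'\in C}\|v'-v\|_{\mathcal N}$, $\mathrm{dist}=\mathrm{dist}_{\mathcal I}$; $\lambda_{\max}$ is the largest eigenvalue; $\mathcal I$ is the identity. $\Sigma_{\vartheta_g},\Sigma_{\varphi_h}$ are fixed self-adjoint positive semi-definite operators with $\langle\xi'-\xi,y'-y\rangle\ge\|y'-y\|^2_{\Sigma_{\vartheta_g}}$ for all $\xi\in\partial\vartheta_g(y)$,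 $\xi'\in\partial\vartheta_g(y')$, and $\langle\zeta'-\zeta,z'-z\rangle\ge\|z'-z\|^2_{\Sigma_{\varphi_h}}$ for all $\zeta\in\partial\varphi_h(z)$, $\zeta'\in\partial\varphi_h(z')$. $\mathcal E:\mathcal X\to\mathcal U$ is the linear operator with adjoint $\mathcal E^*(y,z,x)=\mathcal A^*y+\mathcal B^*z$. $s_\tau:=\frac{5-\tau-3\min\{\tau,\tau^{-1}\}}4$, $t_\tau:=\frac{1-\tau+\min\{\tau,\tau^{-1}\}}8$, $$\mathcal M:=\mathrm{Diag}\big(\mathcal S+\Sigma_{\vartheta_g},\ \mathcal T+\Sigma_{\varphi_h}+\sigma\mathcal B\mathcal B^*,\ (\tau\sigma)^{-1}\mathcal I\big)+s_\tau\sigma\,\mathcal E\mathcal E^*.$$ $\kappa:=\max\{\kappa_1,\kappa_2,\kappa_3\}$ with $\kappa_1=3\|\mathcal S\|$, $\kappa_2=\max\{3\sigma\lambda_{\max}(\mathcal A\mathcal A^* ),2\|\mathcal T\|\}$, $\kappa_3=3(1-\tau)^2\sigma\lambda_{\max}(\mathcal A\mathcal A^* )+2(1-\tau)^2\sigma\lambda_{\max}(\mathcal B\mathcal B^* )+\sigma^{-1}$. *)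

theory Defs
  imports "HOL-Analysis.Analysis"
begin

definition eff_dom :: "('a \<Rightarrow> ereal) \<Rightarrow> 'a set" where
  "eff_dom f = {v. f v < \<infinity>}"

definition ereal_epigraph :: "('a \<Rightarrow> ereal) \<Rightarrow> ('a \<times> real) set" where
  "ereal_epigraph f = {(v, r). f v \<le> ereal r}"

definition proper_closed_convex :: "('a::euclidean_space \<Rightarrow> ereal) \<Rightarrow> bool" where
  "proper_closed_convex f \<longleftrightarrow>
     (\<forall>v. f v \<noteq> -\<infinity>) \<and> eff_dom f \<noteq> {} \<and> closed (ereal_epigraph f) \<and> convex (ereal_epigraph f)"

text \<open>For a proper \<open>f\<close> this set is empty at points outside \<open>eff_dom f\<close>.\<close>

definition subdifferential :: "('a::real_inner \<Rightarrow> ereal) \<Rightarrow> 'a \<Rightarrow> 'a set" where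
  "subdifferential f v = {\<xi>. \<forall>w. f v + ereal (\<xi> \<bullet> (w - v)) \<le> f w}"

text \<open>For proper closed convex \<open>f\<close> the minimizer exists and is unique, so the choice made by
  \<^const>\<open>arg_min\<close> is immaterial.\<close>

definition prox :: "('a::real_inner \<Rightarrow> ereal) \<Rightarrow> 'a \<Rightarrow> 'a" where
  "prox f v = arg_min (\<lambda>w. f w + ereal (1 / 2 * (norm (w - v))\<^sup>2)) (\<lambda>_. True)"

definition self_adjoint :: "('a::euclidean_space \<Rightarrow> 'a) \<Rightarrow> bool" where
  "self_adjoint N \<longleftrightarrow> linear N \<and> adjoint N = N"

definition psd :: "('a::euclidean_space \<Rightarrow> 'a) \<Rightarrow> bool" where
  "psd N \<longleftrightarrow> self_adjoint N \<and> (\<forall>v. 0 \<le> v \<bullet> N v)"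

definition pos_def :: "('a::euclidean_space \<Rightarrow> 'a) \<Rightarrow> bool" where
  "pos_def N \<longleftrightarrow> self_adjoint N \<and> (\<forall>v. v \<noteq> 0 \<longrightarrow> 0 < v \<bullet> N v)"

definition wnorm :: "('a::real_inner \<Rightarrow> 'a) \<Rightarrow> 'a \<Rightarrow> real" where
  "wnorm N v = sqrt (v \<bullet> N v)"

definition wdist :: "('a::real_inner \<Rightarrow> 'a) \<Rightarrow> 'a \<Rightarrow> 'a set \<Rightarrow> real" where
  "wdist N v C = (INF v'\<in>C. wnorm N (v' - v))"

definition lambda_max :: "('a::real_vector \<Rightarrow> 'a) \<Rightarrow> real" where
  "lambda_max N = Max {l. \<exists>v. v \<noteq> 0 \<and> N v = l *\<^sub>R v}"

text \<open>The arguments \<open>dg\<close> and \<open>dh\<close> below are the gradient maps of \<open>g\<close> and \<open>h\<close>; the linear maps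
  \<open>A\<close> and \<open>B\<close> go from the multiplier space into the two primal spaces, so the constraint is
  \<open>adjoint A y + adjoint B z = c\<close>.\<close>

definition kkt_set ::
  "('y::euclidean_space \<Rightarrow> ereal) \<Rightarrow> ('z::euclidean_space \<Rightarrow> ereal) \<Rightarrow> ('y \<Rightarrow> 'y) \<Rightarrow> ('z \<Rightarrow> 'z) \<Rightarrow>
   ('x::euclidean_space \<Rightarrow> 'y) \<Rightarrow> ('x \<Rightarrow> 'z) \<Rightarrow> 'x \<Rightarrow> ('y \<times> 'z \<times> 'x) set" where
  "kkt_set \<theta> \<phi> dg dh A B c = {(y, z, x).
     0 \<in> {\<xi> + dg y + A x |\<xi>. \<xi> \<in> subdifferential \<theta> y} \<and>
     0 \<in> {\<zeta> + dh z + B x |\<zeta>. \<zeta> \<in> subdifferential \<phi> z} \<and>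
     c - adjoint A y - adjoint B z = 0}"

definition kkt_map ::
  "('y::euclidean_space \<Rightarrow> ereal) \<Rightarrow> ('z::euclidean_space \<Rightarrow> ereal) \<Rightarrow> ('y \<Rightarrow> 'y) \<Rightarrow> ('z \<Rightarrow> 'z) \<Rightarrow>
   ('x::euclidean_space \<Rightarrow> 'y) \<Rightarrow> ('x \<Rightarrow> 'z) \<Rightarrow> 'x \<Rightarrow> 'y \<times> 'z \<times> 'x \<Rightarrow> 'y \<times> 'z \<times> 'x" where
  "kkt_map \<theta> \<phi> dg dh A B c = (\<lambda>(y, z, x).
     (y - prox \<theta> (y - (dg y + A x)),
      z - prox \<phi> (z - (dh z + B x)),
      c - adjoint A y - adjoint B z))"

definition aug_lagrangian ::
  "real \<Rightarrow> ('y::euclidean_space \<Rightarrow> ereal) \<Rightarrow> ('z::euclidean_space \<Rightarrow> ereal) \<Rightarrow>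
   ('y \<Rightarrow> real) \<Rightarrow> ('z \<Rightarrow> real) \<Rightarrow> ('x::euclidean_space \<Rightarrow> 'y) \<Rightarrow> ('x \<Rightarrow> 'z) \<Rightarrow> 'x \<Rightarrow>
   'y \<Rightarrow> 'z \<Rightarrow> 'x \<Rightarrow> ereal" where
  "aug_lagrangian \<sigma> \<theta> \<phi> g h A B c y z x =
     (\<theta> y + ereal (g y)) + (\<phi> z + ereal (h z)) +
     ereal (x \<bullet> (adjoint A y + adjoint B z - c) + \<sigma> / 2 * (norm (adjoint A y + adjoint B z - c))\<^sup>2)"

definition sPADMM_sequence ::
  "real \<Rightarrow> real \<Rightarrow> ('y::euclidean_space \<Rightarrow> 'y) \<Rightarrow> ('z::euclidean_space \<Rightarrow> 'z) \<Rightarrow>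
   ('y \<Rightarrow> ereal) \<Rightarrow> ('z \<Rightarrow> ereal) \<Rightarrow> ('y \<Rightarrow> real) \<Rightarrow> ('z \<Rightarrow> real) \<Rightarrow>
   ('x::euclidean_space \<Rightarrow> 'y) \<Rightarrow> ('x \<Rightarrow> 'z) \<Rightarrow> 'x \<Rightarrow>
   (nat \<Rightarrow> 'y) \<Rightarrow> (nat \<Rightarrow> 'z) \<Rightarrow> (nat \<Rightarrow> 'x) \<Rightarrow> bool" where
  "sPADMM_sequence \<sigma> \<tau> S T \<theta> \<phi> g h A B c y z x \<longleftrightarrow>
     y 0 \<in> eff_dom \<theta> \<and> z 0 \<in> eff_dom \<phi> \<and>
     (\<forall>k.
       is_arg_min (\<lambda>w. aug_lagrangian \<sigma> \<theta> \<phi> g h A B c w (z k) (x k)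
                        + ereal (1 / 2 * (wnorm S (w - y k))\<^sup>2)) (\<lambda>_. True) (y (Suc k)) \<and>
       is_arg_min (\<lambda>w. aug_lagrangian \<sigma> \<theta> \<phi> g h A B c (y (Suc k)) w (x k)
                        + ereal (1 / 2 * (wnorm T (w - z k))\<^sup>2)) (\<lambda>_. True) (z (Suc k)) \<and>
       x (Suc k) = x k + (\<tau> * \<sigma>) *\<^sub>R (adjoint A (y (Suc k)) + adjoint B (z (Suc k)) - c))"

definition s_tau :: "real \<Rightarrow> real" where
  "s_tau \<tau> = (5 - \<tau> - 3 * min \<tau> (inverse \<tau>)) / 4"

definition t_tau :: "real \<Rightarrow> real" where
  "t_tau \<tau> = (1 - \<tau> + min \<tau> (inverse \<tau>)) / 8"

definition E_star ::
  "('x::euclidean_space \<Rightarrow> 'y::euclidean_space) \<Rightarrow> ('x \<Rightarrow> 'z::euclidean_space) \<Rightarrow> 'y \<times> 'z \<times> 'x \<Rightarrow> 'x" where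
  "E_star A B = (\<lambda>(y, z, x). adjoint A y + adjoint B z)"

definition E_op ::
  "('x::euclidean_space \<Rightarrow> 'y::euclidean_space) \<Rightarrow> ('x \<Rightarrow> 'z::euclidean_space) \<Rightarrow> 'x \<Rightarrow> 'y \<times> 'z \<times> 'x" where
  "E_op A B = adjoint (E_star A B)"

text \<open>Here \<open>\<Sigma>\<^sub>\<theta>\<close> and \<open>\<Sigma>\<^sub>\<phi>\<close> are strong-monotonicity operators for the subdifferentials of
  \<open>\<theta> + g\<close> and \<open>\<phi> + h\<close>.\<close>

definition M_op ::
  "real \<Rightarrow> real \<Rightarrow> ('y::euclidean_space \<Rightarrow> 'y) \<Rightarrow> ('z::euclidean_space \<Rightarrow> 'z) \<Rightarrow> ('y \<Rightarrow> 'y) \<Rightarrow> ('z \<Rightarrow> 'z) \<Rightarrow>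
   ('x::euclidean_space \<Rightarrow> 'y) \<Rightarrow> ('x \<Rightarrow> 'z) \<Rightarrow> 'y \<times> 'z \<times> 'x \<Rightarrow> 'y \<times> 'z \<times> 'x" where
  "M_op \<sigma> \<tau> S T \<Sigma>\<^sub>\<theta> \<Sigma>\<^sub>\<phi> A B = (\<lambda>(y, z, x).
     (S y + \<Sigma>\<^sub>\<theta> y,
      T z + \<Sigma>\<^sub>\<phi> z + \<sigma> *\<^sub>R B (adjoint B z),
      inverse (\<tau> * \<sigma>) *\<^sub>R x) + (s_tau \<tau> * \<sigma>) *\<^sub>R E_op A B (E_star A B (y, z, x)))"

definition kappa ::
  "real \<Rightarrow> real \<Rightarrow> ('y::euclidean_space \<Rightarrow> 'y) \<Rightarrow> ('z::euclidean_space \<Rightarrow> 'z) \<Rightarrow>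
   ('x::euclidean_space \<Rightarrow> 'y) \<Rightarrow> ('x \<Rightarrow> 'z) \<Rightarrow> real" where
  "kappa \<sigma> \<tau> S T A B =
     (let \<kappa>1 = 3 * onorm S;
          \<kappa>2 = max (3 * \<sigma> * lambda_max (A \<circ> adjoint A)) (2 * onorm T);
          \<kappa>3 = 3 * (1 - \<tau>)\<^sup>2 * \<sigma> * lambda_max (A \<circ> adjoint A)
                + 2 * (1 - \<tau>)\<^sup>2 * \<sigma> * lambda_max (B \<circ> adjoint B) + inverse \<sigma>
      in max \<kappa>1 (max \<kappa>2 \<kappa>3))"

end

theory Submission
  imports Defs
begin

text \<open>
  Write \<open>r\<^sup>k = A\<^sup>*y\<^sup>k + B\<^sup>*z\<^sup>k - c\<close>. Three facts combine to give the linear rate.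

  The optimality conditions of the two subproblems say that \<open>u\<^sup>k\<^sup>+\<^sup>1\<close> solves the KKT system up to
  perturbations that are linear in \<open>r\<^sup>k\<^sup>+\<^sup>1\<close> and in the steps \<open>y\<^sup>k\<^sup>+\<^sup>1 - y\<^sup>k\<close>, \<open>z\<^sup>k\<^sup>+\<^sup>1 - z\<^sup>k\<close>.
  Comparing them with a KKT point by monotonicity of the subdifferentials, and comparing two
  successive \<open>z\<close>-subproblems with each other to control the cross term between \<open>r\<^sup>k\<^sup>+\<^sup>1\<close> and the
  \<open>z\<close>-step, shows that \<open>|u\<^sup>k - p|\<^sub>M\<^sup>2 + |z\<^sup>k - z\<^sup>k\<^sup>-\<^sup>1|\<^sub>T\<^sup>2\<close> decreases for every KKT point \<open>p\<close> by at
  least a quantity that does not depend on \<open>p\<close> (\<open>descent\<close>). The bound on \<open>\<tau>\<close> is what keeps the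
  coefficients of that quantity positive.

  Since \<open>M\<close> is positive definite, this monotonicity bounds the iterates; their cluster points
  are KKT points because the perturbations vanish, and the monotonicity with respect to a cluster
  point forces convergence of the whole sequence (\<open>iterates_converge\<close>).

  The same perturbations bound the KKT residual: \<open>|R(u\<^sup>k\<^sup>+\<^sup>1)|\<^sup>2\<close> is at most \<open>\<kappa>\<close> times the squared
  steps (\<open>residual_bound\<close>). Near the limit the error bound turns this into
  \<open>dist\<^sub>M\<^sup>2(u\<^sup>k\<^sup>+\<^sup>1, \<Omega>) \<le> \<kappa>\<^sub>4\<^sup>-\<^sup>1\<close> times the decrease, and the decrease also dominates
  \<open>|z\<^sup>k\<^sup>+\<^sup>1 - z\<^sup>k|\<^sub>T\<^sup>2\<close>. Hence the decrease is at least a fixed fraction of the new value of the energy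
  (\<open>energy_contraction\<close>). For the finitely many early indices it is enough that the energy
  decreases strictly unless it is zero (\<open>energy_strict\<close>, \<open>uniform_contraction\<close>).
\<close>

section \<open>Positive semidefinite operators\<close>

lemma self_adjoint_inner:
  "self_adjoint N \<Longrightarrow> N v \<bullet> w = v \<bullet> N w"
  unfolding self_adjoint_def by (metis adjoint_works inner_commute)

lemma self_adjointI:
  assumes "linear N" "\<And>v w. N v \<bullet> w = v \<bullet> N w"
  shows "self_adjoint N"
  unfolding self_adjoint_def using assms adjoint_unique[of N N] by auto

lemma psd_linear: "psd N \<Longrightarrow> linear N"
  by (simp add: psd_def self_adjoint_def)

lemma psd_nonneg: "psd N \<Longrightarrow> 0 \<le> v \<bullet> N v"
  by (simp add: psd_def)

lemma psd_inner: "psd N \<Longrightarrow> N v \<bullet> w = v \<bullet> N w"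
  by (simp add: psd_def self_adjoint_inner)

lemma wnorm_squared: "psd N \<Longrightarrow> (wnorm N v)\<^sup>2 = v \<bullet> N v"
  by (simp add: wnorm_def psd_nonneg)

lemma psd_add_quadratic:
  assumes "psd N"
  shows "(v + w) \<bullet> N (v + w) = v \<bullet> N v + 2 * (v \<bullet> N w) + w \<bullet> N w"
  using psd_inner[OF assms, of v w]
  by (simp add: linear_add[OF psd_linear[OF assms]] inner_simps inner_commute)

lemma psd_polarization:
  assumes "psd N"
  shows "2 * ((v' - p) \<bullet> N (v' - v))
    = (v' - p) \<bullet> N (v' - p) - (v - p) \<bullet> N (v - p) + (v' - v) \<bullet> N (v' - v)"
proof -
  have "v - p = (v' - p) + - (v' - v)" by simp
  then show ?thesis
    using psd_add_quadratic[OF assms, of "v' - p" "- (v' - v)"]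
    by (simp only: linear_neg[OF psd_linear[OF assms]] inner_minus_left inner_minus_right)
qed

lemma psd_Young:
  assumes "psd N"
  shows "2 * (v \<bullet> N w) \<le> v \<bullet> N v + w \<bullet> N w"
  using psd_nonneg[OF assms, of "v + - w"]
  by (simp only: psd_add_quadratic[OF assms] linear_neg[OF psd_linear[OF assms]]
      inner_minus_left inner_minus_right)

lemma psd_Cauchy_Schwarz:
  assumes "psd N"
  shows "(v \<bullet> N w)\<^sup>2 \<le> (v \<bullet> N v) * (w \<bullet> N w)"
proof -
  define b where "b = v \<bullet> N w"
  have quad: "0 \<le> v \<bullet> N v + 2 * t * b + t\<^sup>2 * (w \<bullet> N w)" for t
    using psd_nonneg[OF assms, of "v + t *\<^sub>R w"]
    unfolding psd_add_quadratic[OF assms]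
    by (simp add: linear_scale[OF psd_linear[OF assms]] b_def power2_eq_square algebra_simps)
  show ?thesis
  proof (cases "w \<bullet> N w = 0")
    case True
    have "b = 0"
    proof (rule ccontr)
      assume "b \<noteq> 0"
      then show False
        using quad[of "- (v \<bullet> N v + 1) / (2 * b)"] True by (simp add: field_simps)
    qed
    then show ?thesis using True by (simp add: b_def)
  next
    case False
    then have pos: "w \<bullet> N w > 0" using psd_nonneg[OF assms, of w] by linarith
    have "0 \<le> v \<bullet> N v - b\<^sup>2 / (w \<bullet> N w)"
      using quad[of "- b / (w \<bullet> N w)"] pos by (simp add: field_simps power2_eq_square)
    then show ?thesis using pos by (simp add: b_def field_simps)
  qed
qed

lemma psd_kernel:
  assumes "psd N" "v \<bullet> N v = 0"
  shows "N v = 0"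
  using psd_Cauchy_Schwarz[OF assms(1), of "N v" v] assms(2) by auto

text \<open>Cauchy--Schwarz in the seminorm of \<open>N\<close>, applied to \<open>v\<close> and \<open>N v\<close>.\<close>

lemma psd_norm_image_le:
  assumes "psd N"
  shows "(norm (N v))\<^sup>2 \<le> onorm N * (v \<bullet> N v)"
proof (cases "N v = 0")
  case False
  let ?n = "N v \<bullet> N v"
  have n: "?n > 0" using False by simp
  have "bounded_linear N" using psd_linear[OF assms] linear_conv_bounded_linear by blast
  then have "norm (N (N v)) \<le> onorm N * norm (N v)" by (rule onorm)
  then have "N v \<bullet> N (N v) \<le> norm (N v) * (onorm N * norm (N v))"
    by (meson norm_cauchy_schwarz mult_left_mono norm_ge_zero order_trans)
  then have *: "N v \<bullet> N (N v) \<le> onorm N * ?n"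
    by (simp add: dot_square_norm power2_eq_square algebra_simps)
  have "?n * ?n = (v \<bullet> N (N v))\<^sup>2"
    using psd_inner[OF assms, of v "N v"] by (simp add: power2_eq_square)
  also have "\<dots> \<le> (v \<bullet> N v) * (N v \<bullet> N (N v))"
    by (rule psd_Cauchy_Schwarz[OF assms])
  also have "\<dots> \<le> (v \<bullet> N v) * (onorm N * ?n)"
    by (rule mult_left_mono[OF * psd_nonneg[OF assms]])
  finally have "?n * ?n \<le> (onorm N * (v \<bullet> N v)) * ?n" by (simp add: algebra_simps)
  then have "?n \<le> onorm N * (v \<bullet> N v)" by (rule mult_right_le_imp_le[OF _ n])
  then show ?thesis by (simp add: dot_square_norm)
qed (use psd_nonneg[OF assms, of v] in \<open>simp\<close>)

text \<open>\<^const>\<open>lambda_max\<close> is a maximum over a set of eigenvalues, which is meaningful only if that set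
  is finite; for a self-adjoint operator, eigenvectors of distinct eigenvalues are orthogonal, so
  there are at most as many eigenvalues as dimensions.\<close>

lemma finite_eigenvalues:
  fixes N :: "'a::euclidean_space \<Rightarrow> 'a"
  assumes "self_adjoint N"
  shows "finite {l. \<exists>v. v \<noteq> 0 \<and> N v = l *\<^sub>R v}"
proof -
  define L where "L = {l. \<exists>v. v \<noteq> 0 \<and> N v = l *\<^sub>R v}"
  define e where "e l = (SOME v. v \<noteq> 0 \<and> N v = l *\<^sub>R v)" for l
  have e: "e l \<noteq> 0" "N (e l) = l *\<^sub>R e l" if "l \<in> L" for l
  proof -
    have "\<exists>v. v \<noteq> 0 \<and> N v = l *\<^sub>R v" using that unfolding L_def by (rule CollectD)
    from someI_ex[OF this] show "e l \<noteq> 0" "N (e l) = l *\<^sub>R e l" unfolding e_def by blast+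
  qed
  have orth: "e l \<bullet> e l' = 0" if "l \<in> L" "l' \<in> L" "l \<noteq> l'" for l l'
  proof -
    have "N (e l) \<bullet> e l' = e l \<bullet> N (e l')" by (rule self_adjoint_inner[OF assms])
    then have "l * (e l \<bullet> e l') = l' * (e l \<bullet> e l')"
      unfolding e(2)[OF that(1)] e(2)[OF that(2)] by simp
    with that(3) show ?thesis by simp
  qed
  have inj: "inj_on e L"
  proof (rule inj_onI, rule ccontr)
    fix l l' assume "l \<in> L" "l' \<in> L" "e l = e l'" "l \<noteq> l'"
    then show False using orth[of l l'] e(1)[of l] by simp
  qed
  have "pairwise orthogonal (e ` L)"
    using orth by (auto simp: pairwise_def orthogonal_def)
  moreover have "0 \<notin> e ` L" using e(1) by auto
  ultimately have "finite (e ` L)"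
    by (metis pairwise_orthogonal_independent independent_bound)
  with inj have "finite L" by (simp add: finite_image_iff)
  then show ?thesis by (simp only: L_def)
qed

text \<open>A maximizer of the quadratic form on the unit sphere lies in the kernel of the positive
  semidefinite operator \<open>m I - N\<close>, where \<open>m\<close> is the maximum, so \<open>m\<close> is an eigenvalue.\<close>

lemma quadratic_form_le_lambda_max:
  fixes N :: "'a::euclidean_space \<Rightarrow> 'a"
  assumes N: "self_adjoint N"
  shows "v \<bullet> N v \<le> lambda_max N * (norm v)\<^sup>2"
proof -
  have lin: "linear N" using N by (simp add: self_adjoint_def)
  have cont: "continuous_on (sphere 0 1) (\<lambda>v. v \<bullet> N v)"
    by (intro continuous_intros linear_continuous_on) (use lin in \<open>simp add: linear_conv_bounded_linear\<close>)
  have "sphere (0::'a) 1 \<noteq> {}" by simp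
  then obtain e where e: "norm e = 1" and max: "\<And>w. norm w = 1 \<Longrightarrow> w \<bullet> N w \<le> e \<bullet> N e"
    using continuous_attains_sup[OF compact_sphere _ cont] by auto
  define m where "m = e \<bullet> N e"
  have bound: "w \<bullet> N w \<le> m * (norm w)\<^sup>2" for w
  proof (cases "w = 0")
    case False
    have "(inverse (norm w) *\<^sub>R w) \<bullet> N (inverse (norm w) *\<^sub>R w) \<le> m"
      unfolding m_def using False by (intro max) simp
    then show ?thesis using False
      by (simp add: linear_scale[OF lin] power2_eq_square field_simps)
  qed (simp add: linear_0[OF lin])
  have P: "psd (\<lambda>w. m *\<^sub>R w - N w)"
    unfolding psd_def
  proof (intro conjI allI self_adjointI)
    show "linear (\<lambda>w. m *\<^sub>R w - N w)"
      using lin by (intro linear_compose_sub linear_compose_scale_right linear_id[unfolded id_def])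
    show "0 \<le> w \<bullet> (m *\<^sub>R w - N w)" for w
      using bound[of w] by (simp add: inner_simps dot_square_norm)
  qed (simp add: inner_simps self_adjoint_inner[OF N])
  have "m *\<^sub>R e - N e = 0"
    by (rule psd_kernel[OF P]) (use e in \<open>simp add: inner_simps dot_square_norm m_def\<close>)
  then have "m \<in> {l. \<exists>v. v \<noteq> 0 \<and> N v = l *\<^sub>R v}"
    using e by (metis (mono_tags, lifting) eq_iff_diff_eq_0 mem_Collect_eq norm_zero zero_neq_one)
  then have "m \<le> lambda_max N"
    unfolding lambda_max_def by (rule Max_ge[OF finite_eigenvalues[OF N]])
  then show ?thesis
    using bound[of v] by (meson mult_right_mono order_trans zero_le_power2)
qed

lemma psd_gram:
  fixes A :: "'x::euclidean_space \<Rightarrow> 'y::euclidean_space"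
  assumes "linear A"
  shows "psd (A \<circ> adjoint A)"
  unfolding psd_def
proof (intro conjI allI self_adjointI)
  show "linear (A \<circ> adjoint A)"
    by (intro linear_compose adjoint_linear assms)
  show "(A \<circ> adjoint A) v \<bullet> w = v \<bullet> (A \<circ> adjoint A) w" for v w
    using adjoint_works[OF assms, of "adjoint A v" w] adjoint_works[OF assms, of "adjoint A w" v]
    by (simp add: inner_commute)
  show "0 \<le> v \<bullet> (A \<circ> adjoint A) v" for v
    using adjoint_works[OF assms, of "adjoint A v" v] inner_ge_zero[of "adjoint A v"]
    unfolding comp_apply by (simp only: inner_commute[of v])
qed

lemma lambda_max_nonneg:
  fixes N :: "'a::euclidean_space \<Rightarrow> 'a"
  assumes "psd N"
  shows "0 \<le> lambda_max N"
proof -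
  obtain b :: 'a where "b \<in> Basis" using nonempty_Basis by blast
  then show ?thesis
    using quadratic_form_le_lambda_max[of N b] psd_nonneg[OF assms, of b] assms
    by (auto simp: psd_def dest: order_trans)
qed

text \<open>Apply the spectral bound for \<open>A A\<^sup>*\<close> to the vector \<open>A w\<close> and use
  \<open>|A w|\<^sup>2 = \<langle>w, A\<^sup>* A w\<rangle>\<close> with Cauchy--Schwarz.\<close>

lemma norm_image_le_lambda_max:
  fixes A :: "'x::euclidean_space \<Rightarrow> 'y::euclidean_space"
  assumes A: "linear A"
  shows "(norm (A w))\<^sup>2 \<le> lambda_max (A \<circ> adjoint A) * (norm w)\<^sup>2"
proof (cases "A w = 0")
  case False
  let ?n = "(norm (A w))\<^sup>2" and ?l = "lambda_max (A \<circ> adjoint A)"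
  have "?n = w \<bullet> adjoint A (A w)"
    by (simp add: adjoint_works[OF A] dot_square_norm)
  then have "?n\<^sup>2 \<le> (norm w)\<^sup>2 * (norm (adjoint A (A w)))\<^sup>2"
    using Cauchy_Schwarz_ineq[of w "adjoint A (A w)"] by (simp add: dot_square_norm)
  also have "(norm (adjoint A (A w)))\<^sup>2 = A w \<bullet> (A \<circ> adjoint A) (A w)"
    using adjoint_works[OF A, of "adjoint A (A w)" "A w"]
    by (simp add: dot_square_norm[symmetric] inner_commute)
  also have "(norm w)\<^sup>2 * \<dots> \<le> (norm w)\<^sup>2 * (?l * ?n)"
    using psd_gram[OF A] unfolding psd_def
    by (intro mult_left_mono quadratic_form_le_lambda_max zero_le_power2) blast
  finally have "?n * ?n \<le> (?l * (norm w)\<^sup>2) * ?n" by (simp add: power2_eq_square algebra_simps)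
  then show ?thesis by (rule mult_right_le_imp_le[where c = ?n]) (use False in simp)
qed (use lambda_max_nonneg[OF psd_gram[OF A]] in simp)

lemma psd_definite_coercive:
  fixes N :: "'a::euclidean_space \<Rightarrow> 'a"
  assumes N: "psd N" and def: "\<And>v. v \<bullet> N v = 0 \<Longrightarrow> v = 0"
  obtains m where "m > 0" "\<And>v. m * (norm v)\<^sup>2 \<le> v \<bullet> N v"
proof -
  have lin: "linear N" by (rule psd_linear[OF N])
  have cont: "continuous_on (sphere 0 1) (\<lambda>v. v \<bullet> N v)"
    by (intro continuous_intros linear_continuous_on) (use lin in \<open>simp add: linear_conv_bounded_linear\<close>)
  have "sphere (0::'a) 1 \<noteq> {}" by simp
  then obtain e where e: "norm e = 1" and min: "\<And>w. norm w = 1 \<Longrightarrow> e \<bullet> N e \<le> w \<bullet> N w"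
    using continuous_attains_inf[OF compact_sphere _ cont] by auto
  show thesis
  proof
    show "e \<bullet> N e > 0"
      using def[of e] psd_nonneg[OF N, of e] e by (metis norm_zero order_le_less zero_neq_one)
    show "(e \<bullet> N e) * (norm v)\<^sup>2 \<le> v \<bullet> N v" for v
    proof (cases "v = 0")
      case False
      have "e \<bullet> N e \<le> (inverse (norm v) *\<^sub>R v) \<bullet> N (inverse (norm v) *\<^sub>R v)"
        using False by (intro min) simp
      then show ?thesis using False
        by (simp add: linear_scale[OF lin] power2_eq_square field_simps)
    qed (simp add: linear_0[OF lin])
  qed
qed

section \<open>Weighted distances\<close>

lemma wnorm_nonneg: "psd N \<Longrightarrow> 0 \<le> wnorm N v"
  by (simp add: wnorm_def psd_nonneg)

lemma wdist_le:
  assumes "psd N" "p \<in> C"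
  shows "wdist N v C \<le> wnorm N (p - v)"
  unfolding wdist_def using assms
  by (intro cINF_lower) (auto intro!: bdd_belowI[of _ 0] simp: wnorm_nonneg)

lemma wdist_nonneg:
  assumes "psd N" "C \<noteq> {}"
  shows "0 \<le> wdist N v C"
  unfolding wdist_def using assms by (intro cINF_greatest) (auto simp: wnorm_nonneg)

lemma wdist_squared_le:
  assumes N: "psd N" and p: "p \<in> C"
  shows "(wdist N v C)\<^sup>2 \<le> (v - p) \<bullet> N (v - p)"
proof -
  have "(wdist N v C)\<^sup>2 \<le> (wnorm N (p - v))\<^sup>2"
    using wdist_le[OF N p] wdist_nonneg[OF N] p by (intro power_mono) auto
  also have "\<dots> = (v - p) \<bullet> N (v - p)"
    using linear_diff[OF psd_linear[OF N]] by (simp add: wnorm_squared[OF N] inner_simps)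
  finally show ?thesis .
qed

text \<open>Used to take the infimum over \<open>C\<close> in an inequality that holds for each of its points.\<close>

lemma le_wdist_squared:
  assumes N: "psd N" and C: "C \<noteq> {}" and le: "\<And>p. p \<in> C \<Longrightarrow> K \<le> (v - p) \<bullet> N (v - p)"
  shows "K \<le> (wdist N v C)\<^sup>2"
proof (cases "K \<le> 0")
  case False
  have "sqrt K \<le> wdist N v C"
    unfolding wdist_def
  proof (rule cINF_greatest[OF C])
    fix p assume "p \<in> C"
    have "(v - p) \<bullet> N (v - p) = (p - v) \<bullet> N (p - v)"
      using linear_diff[OF psd_linear[OF N]] by (simp add: inner_simps)
    then show "sqrt K \<le> wnorm N (p - v)"
      unfolding wnorm_def using le[OF \<open>p \<in> C\<close>] by simp
  qed
  then have "(sqrt K)\<^sup>2 \<le> (wdist N v C)\<^sup>2" using False by (intro power_mono) auto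
  then show ?thesis using False by simp
qed (use order_trans[OF _ zero_le_power2] in blast)

text \<open>This converts the error bound, which is stated with the Euclidean distance, into one for the
  weighted distance.\<close>

lemma wdist_squared_le_lambda_max:
  fixes N :: "'a::euclidean_space \<Rightarrow> 'a"
  assumes N: "psd N" and C: "C \<noteq> {}"
  shows "(wdist N v C)\<^sup>2 \<le> lambda_max N * (infdist v C)\<^sup>2"
proof -
  let ?l = "lambda_max N"
  have l: "0 \<le> ?l" by (rule lambda_max_nonneg[OF N])
  have "wdist N v C \<le> sqrt ?l * dist v p" if "p \<in> C" for p
  proof -
    have "wnorm N (p - v) \<le> sqrt (?l * (norm (p - v))\<^sup>2)"
      unfolding wnorm_def using quadratic_form_le_lambda_max[of N "p - v"] N by (simp add: psd_def)
    then show ?thesis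
      using wdist_le[OF N that, of v] by (simp add: real_sqrt_mult dist_norm norm_minus_commute)
  qed
  then have "wdist N v C \<le> sqrt ?l * infdist v C"
  proof (cases "?l = 0")
    case False
    then have pos: "sqrt ?l > 0" using l by simp
    assume *: "\<And>p. p \<in> C \<Longrightarrow> wdist N v C \<le> sqrt ?l * dist v p"
    have "wdist N v C / sqrt ?l \<le> infdist v C"
      unfolding infdist_notempty[OF C] using pos *
      by (intro cINF_greatest[OF C]) (simp add: divide_le_eq mult.commute)
    then show ?thesis using pos by (simp add: divide_le_eq mult.commute)
  qed (use C in auto)
  then have "(wdist N v C)\<^sup>2 \<le> (sqrt ?l * infdist v C)\<^sup>2"
    using wdist_nonneg[OF N C] by (intro power_mono) auto
  then show ?thesis using l by (simp add: power_mult_distrib)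
qed

section \<open>Subgradients and proximal points\<close>

lemma pcc_not_MInf: "proper_closed_convex f \<Longrightarrow> f v \<noteq> -\<infinity>"
  by (simp add: proper_closed_convex_def)

lemma subgradient_finite:
  assumes f: "proper_closed_convex f" and \<xi>: "\<xi> \<in> subdifferential f v"
  obtains r where "f v = ereal r"
proof -
  obtain w where "f w < \<infinity>" using f by (auto simp: proper_closed_convex_def eff_dom_def)
  moreover have "f v + ereal (\<xi> \<bullet> (w - v)) \<le> f w" using \<xi> by (simp add: subdifferential_def)
  ultimately have "f v \<noteq> \<infinity>" by auto
  with pcc_not_MInf[OF f, of v] that show thesis by (cases "f v") auto
qed

lemma pcc_convex_ineq:
  assumes f: "proper_closed_convex f" and "f v = ereal a" "f w = ereal b" "0 \<le> t" "t \<le> 1"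
  shows "f ((1 - t) *\<^sub>R v + t *\<^sub>R w) \<le> ereal ((1 - t) * a + t * b)"
proof -
  have "convex (ereal_epigraph f)" using f by (simp add: proper_closed_convex_def)
  moreover have "(v, a) \<in> ereal_epigraph f" "(w, b) \<in> ereal_epigraph f"
    using assms by (simp_all add: ereal_epigraph_def)
  ultimately have "(1 - t) *\<^sub>R (v, a) + t *\<^sub>R (w, b) \<in> ereal_epigraph f"
    using assms(4,5) by (intro convexD) auto
  then show ?thesis by (simp add: ereal_epigraph_def)
qed

lemma has_derivative_right_quotient:
  fixes F :: "'a::real_inner \<Rightarrow> real"
  assumes "(F has_derivative (\<lambda>d. G \<bullet> d)) (at p)"
  shows "((\<lambda>t. (F (p + t *\<^sub>R d) - F p) / t) \<longlongrightarrow> G \<bullet> d) (at_right 0)"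
proof -
  have "((\<lambda>t. F (p + t *\<^sub>R d)) has_derivative (\<lambda>t. G \<bullet> (t *\<^sub>R d))) (at 0)"
    by (rule has_derivative_compose[where f = "\<lambda>t. p + t *\<^sub>R d" and g = F, simplified])
       (use assms in \<open>auto intro!: derivative_eq_intros\<close>)
  then have "((\<lambda>t. F (p + t *\<^sub>R d)) has_field_derivative (G \<bullet> d)) (at 0)"
    unfolding has_field_derivative_def inner_scaleR_right by (metis (no_types, lifting) ext mult.commute)
  then have "((\<lambda>t. (F (p + t *\<^sub>R d) - F p) / t) \<longlongrightarrow> G \<bullet> d) (at 0)"
    by (simp add: DERIV_def)
  then show ?thesis by (rule tendsto_mono[rotated]) (rule at_le, simp)
qed

text \<open>The first-order condition: along the segment from the minimizer \<open>p\<close> to \<open>w\<close>, convexity of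
  \<open>f\<close> bounds its increments, so the difference quotients of \<open>F\<close> are bounded below by
  \<open>f p - f w\<close>.\<close>

lemma minimizer_subgradient:
  fixes f :: "'a::euclidean_space \<Rightarrow> ereal"
  assumes f: "proper_closed_convex f"
    and D: "(F has_derivative (\<lambda>d. G \<bullet> d)) (at p)"
    and fin: "f p < \<infinity>"
    and min: "\<And>w. f p + ereal (F p) \<le> f w + ereal (F w)"
  shows "- G \<in> subdifferential f p"
proof -
  obtain a where a: "f p = ereal a" using fin pcc_not_MInf[OF f, of p] by (cases "f p") auto
  have "f p + ereal ((- G) \<bullet> (w - p)) \<le> f w" for w
  proof (cases "f w")
    case (real b)
    have quot: "a - b \<le> (F (p + t *\<^sub>R (w - p)) - F p) / t" if t: "0 < t" "t \<le> 1" for t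
    proof -
      have eq: "(1 - t) *\<^sub>R p + t *\<^sub>R w = p + t *\<^sub>R (w - p)" by (simp add: algebra_simps)
      have "f (p + t *\<^sub>R (w - p)) \<le> ereal ((1 - t) * a + t * b)"
        using pcc_convex_ineq[OF f a real, of t] t unfolding eq by auto
      then have "f (p + t *\<^sub>R (w - p)) + ereal (F (p + t *\<^sub>R (w - p)))
          \<le> ereal ((1 - t) * a + t * b) + ereal (F (p + t *\<^sub>R (w - p)))"
        by (rule add_right_mono)
      with min[of "p + t *\<^sub>R (w - p)"]
      have "f p + ereal (F p) \<le> ereal ((1 - t) * a + t * b) + ereal (F (p + t *\<^sub>R (w - p)))"
        by (rule order_trans)
      then have "a + F p \<le> (1 - t) * a + t * b + F (p + t *\<^sub>R (w - p))" by (simp add: a)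
      then show ?thesis using t by (simp add: field_simps)
    qed
    note lim = has_derivative_right_quotient[OF D, of "w - p"]
    have ev: "\<forall>\<^sub>F t in at_right 0. a - b \<le> (F (p + t *\<^sub>R (w - p)) - F p) / t"
      by (rule eventually_mono[OF eventually_at_right_real[OF zero_less_one]]) (use quot in auto)
    have "a - b \<le> G \<bullet> (w - p)"
      by (rule tendsto_lowerbound[OF lim ev]) simp
    then show ?thesis using a real by simp
  qed (use pcc_not_MInf[OF f, of w] in auto)
  then show ?thesis by (simp add: subdifferential_def)
qed

lemma subdifferential_mono:
  assumes f: "proper_closed_convex f"
    and "\<xi> \<in> subdifferential f v" "\<xi>' \<in> subdifferential f v'"
  shows "0 \<le> (\<xi>' - \<xi>) \<bullet> (v' - v)"
proof -
  obtain a a' where a: "f v = ereal a" "f v' = ereal a'"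
    using subgradient_finite[OF f] assms(2,3) by metis
  have "f v + ereal (\<xi> \<bullet> (v' - v)) \<le> f v'" "f v' + ereal (\<xi>' \<bullet> (v - v')) \<le> f v"
    using assms(2,3) by (simp_all add: subdifferential_def)
  then show ?thesis by (simp add: a inner_simps)
qed

text \<open>Passing to the limit in the subgradient inequality needs lower semicontinuity of \<open>f\<close> at
  the limit point, which is the closedness of its epigraph.\<close>

lemma subdifferential_closed_graph:
  fixes f :: "'a::euclidean_space \<Rightarrow> ereal"
  assumes f: "proper_closed_convex f"
    and sub: "\<And>n. \<xi> n \<in> subdifferential f (v n)"
    and lim: "\<xi> \<longlonglongrightarrow> \<xi>0" "v \<longlonglongrightarrow> v0"
  shows "\<xi>0 \<in> subdifferential f v0"
proof -
  have "f v0 + ereal (\<xi>0 \<bullet> (w - v0)) \<le> f w" for w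
  proof (cases "f w")
    case (real b)
    have mem: "(v n, b - \<xi> n \<bullet> (w - v n)) \<in> ereal_epigraph f" for n
    proof -
      obtain a where a: "f (v n) = ereal a" using subgradient_finite[OF f sub] .
      have "f (v n) + ereal (\<xi> n \<bullet> (w - v n)) \<le> f w" using sub[of n] by (simp add: subdifferential_def)
      then show ?thesis by (simp add: a real ereal_epigraph_def)
    qed
    have tends: "(\<lambda>n. (v n, b - \<xi> n \<bullet> (w - v n))) \<longlonglongrightarrow> (v0, b - \<xi>0 \<bullet> (w - v0))"
      by (intro tendsto_intros lim)
    have "closed (ereal_epigraph f)" using f by (simp add: proper_closed_convex_def)
    then have "(v0, b - \<xi>0 \<bullet> (w - v0)) \<in> ereal_epigraph f"
      by (rule closed_sequentially[OF _ mem tends])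
    then have "f v0 \<le> ereal (b - \<xi>0 \<bullet> (w - v0))" by (simp add: ereal_epigraph_def)
    then show ?thesis using real by (cases "f v0") auto
  qed (use pcc_not_MInf[OF f, of w] in auto)
  then show ?thesis by (simp add: subdifferential_def)
qed

text \<open>A subgradient at one point supplies the affine minorant that makes the proximal objective
  coercive. Its sublevel set is best described in the epigraph, where it is compact and the
  objective is the continuous function \<open>r + |w - v|\<^sup>2 / 2\<close>.\<close>

lemma prox_minimizes:
  fixes f :: "'a::euclidean_space \<Rightarrow> ereal"
  assumes f: "proper_closed_convex f" and \<xi>: "\<xi> \<in> subdifferential f y"
  shows "f (prox f v) + ereal (1 / 2 * (norm (prox f v - v))\<^sup>2) \<le> f w + ereal (1 / 2 * (norm (w - v))\<^sup>2)"
proof -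
  obtain a where a: "f y = ereal a" using subgradient_finite[OF f \<xi>] .
  define H :: "'a \<times> real \<Rightarrow> real" where "H = (\<lambda>p. snd p + 1/2 * (norm (fst p - v))\<^sup>2)"
  define K where "K = ereal_epigraph f \<inter> {p. H p \<le> H (y, a)}"
  have contH: "continuous_on S H" for S unfolding H_def by (intro continuous_intros)
  have minor: "a + \<xi> \<bullet> (w - y) \<le> r" if "(w, r) \<in> ereal_epigraph f" for w r
  proof -
    have "f y + ereal (\<xi> \<bullet> (w - y)) \<le> f w" using \<xi> by (simp add: subdifferential_def)
    also have "f w \<le> ereal r" using that by (simp add: ereal_epigraph_def)
    finally show ?thesis by (simp add: a)
  qed
  \<comment> \<open>Completing the square in the minorant plus the quadratic centres the bound at \<open>v - \<xi>\<close>.\<close>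
  define \<rho> where "\<rho> = sqrt (2 * (H (y, a) - a - \<xi> \<bullet> (v - y)) + (norm \<xi>)\<^sup>2)"
  have ball: "norm (w - (v - \<xi>)) \<le> \<rho>" if "(w, r) \<in> K" for w r
  proof -
    have 1: "r + 1/2 * (norm (w - v))\<^sup>2 \<le> H (y, a)"
      using that by (auto simp: K_def H_def)
    have 2: "a + \<xi> \<bullet> (w - y) \<le> r" using that minor by (auto simp: K_def)
    have 3: "2 * (a + \<xi> \<bullet> (w - y)) + (norm (w - v))\<^sup>2 \<le> 2 * H (y, a)"
      using mult_left_mono[OF 1, of 2] mult_left_mono[OF 2, of 2] by (simp add: distrib_left)
    have "(norm (w - (v - \<xi>)))\<^sup>2
        = (norm (w - v))\<^sup>2 + 2 * (\<xi> \<bullet> (w - y)) - 2 * (\<xi> \<bullet> (v - y)) + (norm \<xi>)\<^sup>2"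
      unfolding power2_norm_eq_inner by (simp add: inner_simps inner_commute)
    then have "(norm (w - (v - \<xi>)))\<^sup>2 \<le> 2 * (H (y, a) - a - \<xi> \<bullet> (v - y)) + (norm \<xi>)\<^sup>2"
      using 3 by (simp add: algebra_simps)
    then show ?thesis unfolding \<rho>_def by (rule real_le_rsqrt)
  qed
  have "K \<subseteq> cball (v - \<xi>) \<rho> \<times> {a - norm \<xi> * (norm (v - \<xi> - y) + \<rho>) .. H (y, a)}"
  proof
    fix p assume p: "p \<in> K"
    obtain w r where wr: "p = (w, r)" by (cases p)
    have w: "norm (w - (v - \<xi>)) \<le> \<rho>" using ball p wr by blast
    have "norm (w - y) \<le> norm (v - \<xi> - y) + \<rho>"
      using norm_triangle_ineq[of "w - (v - \<xi>)" "v - \<xi> - y"] w by simp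
    then have "norm \<xi> * norm (w - y) \<le> norm \<xi> * (norm (v - \<xi> - y) + \<rho>)"
      by (rule mult_left_mono) simp
    moreover have "- (norm \<xi> * norm (w - y)) \<le> \<xi> \<bullet> (w - y)"
      using Cauchy_Schwarz_ineq2[of \<xi> "w - y"] by linarith
    moreover have "a + \<xi> \<bullet> (w - y) \<le> r"
      using p minor by (auto simp: wr K_def)
    moreover have "r \<le> H (y, a)"
    proof -
      have "r \<le> H (w, r)" by (simp add: H_def)
      also have "\<dots> \<le> H (y, a)" using p by (simp add: wr K_def)
      finally show ?thesis .
    qed
    ultimately show "p \<in> cball (v - \<xi>) \<rho> \<times> {a - norm \<xi> * (norm (v - \<xi> - y) + \<rho>) .. H (y, a)}"
      using w by (simp add: wr dist_norm norm_minus_commute)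
  qed
  then have "bounded K" by (rule bounded_subset[rotated]) (intro bounded_Times bounded_cball bounded_closed_interval)
  moreover have "closed {p. H p \<le> H (y, a)}"
    using contH by (intro closed_Collect_le) auto
  then have "closed K" unfolding K_def using f by (intro closed_Int) (auto simp: proper_closed_convex_def)
  ultimately have "compact K" by (simp add: compact_eq_bounded_closed)
  moreover have yK: "(y, a) \<in> K" by (simp add: K_def ereal_epigraph_def a)
  ultimately obtain p where pK: "p \<in> K" and pmin: "\<And>q. q \<in> K \<Longrightarrow> H p \<le> H q"
    using continuous_attains_inf[OF _ _ contH, of K] by blast
  obtain w0 r0 where p: "p = (w0, r0)" by (cases p)
  have min: "f w0 + ereal (1 / 2 * (norm (w0 - v))\<^sup>2) \<le> f w + ereal (1 / 2 * (norm (w - v))\<^sup>2)" for w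
  proof (cases "f w")
    case (real b)
    have "H p \<le> H (w, b)"
    proof (cases "H (w, b) \<le> H (y, a)")
      case True then show ?thesis using real by (intro pmin) (simp add: K_def ereal_epigraph_def)
    next
      case False then show ?thesis using pmin[OF yK] by linarith
    qed
    moreover have "f w0 \<le> ereal r0" using pK by (simp add: K_def p ereal_epigraph_def)
    ultimately show ?thesis using real by (cases "f w0") (auto simp: H_def p)
  qed (use pcc_not_MInf[OF f, of w] in auto)
  have "is_arg_min (\<lambda>w. f w + ereal (1 / 2 * (norm (w - v))\<^sup>2)) (\<lambda>_. True) (prox f v)"
    unfolding prox_def arg_min_def by (rule someI[of _ w0]) (use min in \<open>simp add: is_arg_min_def not_less\<close>)
  then show ?thesis by (simp add: is_arg_min_def not_less)
qed

lemma has_derivative_norm_squared_half: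
  fixes v :: "'a::real_inner"
  shows "((\<lambda>w. 1 / 2 * (norm (w - v))\<^sup>2) has_derivative (\<lambda>d. (p - v) \<bullet> d)) (at p)"
  unfolding power2_norm_eq_inner by (auto intro!: derivative_eq_intros simp: inner_commute)

text \<open>The optimality condition of \<open>q = prox f (y - d)\<close> says \<open>y - d - q \<in> \<partial>f q\<close>; comparing it
  with \<open>\<xi> \<in> \<partial>f y\<close> by monotonicity gives the bound.\<close>

lemma prox_residual_le:
  fixes f :: "'a::euclidean_space \<Rightarrow> ereal"
  assumes f: "proper_closed_convex f" and \<xi>: "\<xi> \<in> subdifferential f y"
  shows "norm (y - prox f (y - d)) \<le> norm (\<xi> + d)"
proof -
  define q where "q = prox f (y - d)"
  note min = prox_minimizes[OF f \<xi>, of "y - d", folded q_def]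
  obtain a where "f y = ereal a" using subgradient_finite[OF f \<xi>] .
  then have "f q < \<infinity>" using min[of y] by auto
  then have "- (q - (y - d)) \<in> subdifferential f q"
    using minimizer_subgradient[OF f has_derivative_norm_squared_half _ min] by blast
  from subdifferential_mono[OF f this \<xi>]
  have "(norm (y - q))\<^sup>2 \<le> (\<xi> + d) \<bullet> (y - q)"
    unfolding power2_norm_eq_inner by (simp add: inner_simps inner_commute)
  also have "\<dots> \<le> norm (\<xi> + d) * norm (y - q)" by (rule norm_cauchy_schwarz)
  finally show ?thesis unfolding q_def[symmetric]
    by (cases "y = q") (simp_all add: power2_eq_square)
qed

lemma gradient_inequality:
  fixes g :: "'a::real_inner \<Rightarrow> real"
  assumes g: "convex_on UNIV g" and D: "GDERIV g v :> d"
  shows "g v + d \<bullet> (w - v) \<le> g w"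
proof -
  have lim: "((\<lambda>t. (g (v + t *\<^sub>R (w - v)) - g v) / t) \<longlongrightarrow> d \<bullet> (w - v)) (at_right 0)"
    using D by (intro has_derivative_right_quotient) (simp add: gderiv_def inner_commute)
  have quot: "(g (v + t *\<^sub>R (w - v)) - g v) / t \<le> g w - g v" if "0 < t" "t \<le> 1" for t
  proof -
    have "g ((1 - t) *\<^sub>R v + t *\<^sub>R w) \<le> (1 - t) * g v + t * g w"
      using that by (intro convex_onD[OF g]) auto
    moreover have "(1 - t) *\<^sub>R v + t *\<^sub>R w = v + t *\<^sub>R (w - v)" by (simp add: algebra_simps)
    ultimately show ?thesis using that by (simp add: field_simps)
  qed
  have "\<forall>\<^sub>F t in at_right 0. (g (v + t *\<^sub>R (w - v)) - g v) / t \<le> g w - g v"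
    by (rule eventually_mono[OF eventually_at_right_real[OF zero_less_one]]) (use quot in auto)
  then have "d \<bullet> (w - v) \<le> g w - g v" by (rule tendsto_upperbound[OF lim]) simp
  then show ?thesis by simp
qed

lemma subdifferential_add_gradient:
  assumes f: "proper_closed_convex f" and g: "convex_on UNIV g" "GDERIV g v :> d"
    and \<xi>: "\<xi> \<in> subdifferential f v"
  shows "\<xi> + d \<in> subdifferential (\<lambda>w. f w + ereal (g w)) v"
proof -
  obtain a where a: "f v = ereal a" using subgradient_finite[OF f \<xi>] .
  have "f v + ereal (g v) + ereal ((\<xi> + d) \<bullet> (w - v)) \<le> f w + ereal (g w)" for w
  proof -
    have "f v + ereal (\<xi> \<bullet> (w - v)) \<le> f w" using \<xi> by (simp add: subdifferential_def)
    then show ?thesis using gradient_inequality[OF g, of w] a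
      by (cases "f w") (auto simp: inner_simps)
  qed
  then show ?thesis by (simp add: subdifferential_def)
qed

section \<open>The iteration and its optimality conditions\<close>

text \<open>Both subproblems of the iteration have this form: \<open>C\<close> is \<open>A\<close> or \<open>B\<close>, the multiplier is \<open>a\<close>,
  and \<open>b\<close> collects the part of the constraint that the other block has fixed.\<close>

lemma proximal_step_subgradient:
  fixes C :: "'x::euclidean_space \<Rightarrow> 'a::euclidean_space"
  assumes f: "proper_closed_convex f" and C: "linear C" and N: "psd N"
    and q: "GDERIV q p :> d" and fin: "f p < \<infinity>"
    and min: "\<And>w. f p + ereal (q p + a \<bullet> (adjoint C p + b) + \<sigma> / 2 * (norm (adjoint C p + b))\<^sup>2
                 + 1 / 2 * ((p - p0) \<bullet> N (p - p0)))
             \<le> f w + ereal (q w + a \<bullet> (adjoint C w + b) + \<sigma> / 2 * (norm (adjoint C w + b))\<^sup>2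
                 + 1 / 2 * ((w - p0) \<bullet> N (w - p0)))"
  shows "- (d + C (a + \<sigma> *\<^sub>R (adjoint C p + b)) + N (p - p0)) \<in> subdifferential f p"
proof (rule minimizer_subgradient[OF f _ fin min])
  have bl: "bounded_linear (adjoint C)" "bounded_linear N"
    using adjoint_linear[OF C] psd_linear[OF N] by (simp_all add: linear_conv_bounded_linear)
  note [derivative_intros] = bounded_linear.has_derivative[OF bl(1)] bounded_linear.has_derivative[OF bl(2)]
  have q': "(q has_derivative (\<lambda>h. h \<bullet> d)) (at p)" using q by (simp add: gderiv_def)
  have 1: "v \<bullet> adjoint C h = C v \<bullet> h" for v h
    using adjoint_works[OF C, of v h] .
  have 2: "(p - p0) \<bullet> N h = N (p - p0) \<bullet> h" for h
    using psd_inner[OF N, of "p - p0" h] by simp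
  have 3: "C (a + \<sigma> *\<^sub>R v) = C a + \<sigma> *\<^sub>R C v" for v
    using C by (simp add: linear_add linear_scale)
  show "((\<lambda>w. q w + a \<bullet> (adjoint C w + b) + \<sigma> / 2 * (norm (adjoint C w + b))\<^sup>2
          + 1 / 2 * ((w - p0) \<bullet> N (w - p0))) has_derivative
        (\<lambda>h. (d + C (a + \<sigma> *\<^sub>R (adjoint C p + b)) + N (p - p0)) \<bullet> h)) (at p)"
    unfolding power2_norm_eq_inner
    by (rule derivative_eq_intros q' refl ext)+
       (simp add: 1 2 3 inner_commute[of "adjoint C _"] inner_commute[of _ d]
          inner_commute[of _ "N (p - p0)"] inner_add_left)
qed

lemma zero_in_translate:
  fixes e e' :: "'a::ab_group_add"
  shows "(\<exists>\<xi>. 0 = \<xi> + e + e' \<and> \<xi> \<in> X) \<longleftrightarrow> - (e + e') \<in> X"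
proof -
  have "0 = \<xi> + e + e' \<longleftrightarrow> \<xi> = - (e + e')" for \<xi>
    by (metis add.assoc add.left_inverse eq_neg_iff_add_eq_0)
  then show ?thesis by auto
qed

text \<open>The assumptions shared by the whole convergence analysis. A KKT point and the error bound enter
  as explicit premises of the lemmas: \<open>descent\<close> is a statement about each KKT point separately, and
  the error bound is invoked only around the limit, which has to be found first.\<close>

locale spadmm =
  fixes \<theta> :: "'y::euclidean_space \<Rightarrow> ereal" and \<phi> :: "'z::euclidean_space \<Rightarrow> ereal"
    and g :: "'y \<Rightarrow> real" and h :: "'z \<Rightarrow> real"
    and dg :: "'y \<Rightarrow> 'y" and dh :: "'z \<Rightarrow> 'z"
    and A :: "'x::euclidean_space \<Rightarrow> 'y" and B :: "'x \<Rightarrow> 'z" and c :: 'x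
    and \<sigma> \<tau> :: real
    and S \<Sigma>\<^sub>\<theta> :: "'y \<Rightarrow> 'y" and T \<Sigma>\<^sub>\<phi> :: "'z \<Rightarrow> 'z"
    and y :: "nat \<Rightarrow> 'y" and z :: "nat \<Rightarrow> 'z" and x :: "nat \<Rightarrow> 'x"
  assumes \<theta>: "proper_closed_convex \<theta>" and \<phi>: "proper_closed_convex \<phi>"
    and g: "convex_on UNIV g" "\<And>v. GDERIV g v :> dg v" "continuous_on UNIV dg"
    and h: "convex_on UNIV h" "\<And>w. GDERIV h w :> dh w" "continuous_on UNIV dh"
    and A: "linear A" and B: "linear B"
    and \<sigma>: "\<sigma> > 0"
    and \<tau>: "0 < \<tau>" "\<tau> < (1 + sqrt 5) / 2"
    and S: "psd S" and T: "psd T"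
    and \<Sigma>\<theta>: "psd \<Sigma>\<^sub>\<theta>" and \<Sigma>\<phi>: "psd \<Sigma>\<^sub>\<phi>"
    and mono_\<theta>: "\<And>v v' \<xi> \<xi>'. \<xi> \<in> subdifferential (\<lambda>w. \<theta> w + ereal (g w)) v \<Longrightarrow>
           \<xi>' \<in> subdifferential (\<lambda>w. \<theta> w + ereal (g w)) v' \<Longrightarrow>
           (\<xi>' - \<xi>) \<bullet> (v' - v) \<ge> (wnorm \<Sigma>\<^sub>\<theta> (v' - v))\<^sup>2"
    and mono_\<phi>: "\<And>w w' \<zeta> \<zeta>'. \<zeta> \<in> subdifferential (\<lambda>v. \<phi> v + ereal (h v)) w \<Longrightarrow>
           \<zeta>' \<in> subdifferential (\<lambda>v. \<phi> v + ereal (h v)) w' \<Longrightarrow>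
           (\<zeta>' - \<zeta>) \<bullet> (w' - w) \<ge> (wnorm \<Sigma>\<^sub>\<phi> (w' - w))\<^sup>2"
    and posdef_y: "pos_def (\<lambda>v. \<Sigma>\<^sub>\<theta> v + S v + \<sigma> *\<^sub>R A (adjoint A v))"
    and posdef_z: "pos_def (\<lambda>w. \<Sigma>\<^sub>\<phi> w + T w + \<sigma> *\<^sub>R B (adjoint B w))"
    and sequence: "sPADMM_sequence \<sigma> \<tau> S T \<theta> \<phi> g h A B c y z x"
begin

abbreviation "As \<equiv> adjoint A"
abbreviation "Bs \<equiv> adjoint B"

definition "\<Omega> = kkt_set \<theta> \<phi> dg dh A B c"
definition "M = M_op \<sigma> \<tau> S T \<Sigma>\<^sub>\<theta> \<Sigma>\<^sub>\<phi> A B"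
definition "u k = (y k, z k, x k)"
definition "res k = As (y k) + Bs (z k) - c"

lemma As_linear: "linear As" and Bs_linear: "linear Bs"
  using A B by (simp_all add: adjoint_linear)

lemmas linear_simps =
  linear_add[OF A] linear_diff[OF A] linear_scale[OF A] linear_neg[OF A]
  linear_add[OF B] linear_diff[OF B] linear_scale[OF B] linear_neg[OF B]
  linear_add[OF As_linear] linear_diff[OF As_linear] linear_scale[OF As_linear]
  linear_add[OF Bs_linear] linear_diff[OF Bs_linear] linear_scale[OF Bs_linear]
  linear_add[OF psd_linear[OF S]] linear_diff[OF psd_linear[OF S]] linear_scale[OF psd_linear[OF S]]
  linear_add[OF psd_linear[OF T]] linear_diff[OF psd_linear[OF T]] linear_scale[OF psd_linear[OF T]]

lemma A_inner: "A v \<bullet> w = v \<bullet> As w" and B_inner: "B v \<bullet> w' = v \<bullet> Bs w'"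
  by (simp_all add: adjoint_works[OF A] adjoint_works[OF B])

lemma kkt_iff:
  "(a, b, d) \<in> \<Omega> \<longleftrightarrow>
     - (dg a + A d) \<in> subdifferential \<theta> a \<and> - (dh b + B d) \<in> subdifferential \<phi> b \<and> As a + Bs b = c"
proof -
  have "c - As a - Bs b = 0 \<longleftrightarrow> As a + Bs b = c" by (auto simp: diff_diff_eq)
  then show ?thesis
    unfolding \<Omega>_def kkt_set_def mem_Collect_eq case_prod_conv zero_in_translate by blast
qed

lemma x_Suc: "x (Suc k) = x k + (\<tau> * \<sigma>) *\<^sub>R res (Suc k)"
  using sequence by (simp add: sPADMM_sequence_def res_def)

text \<open>The other block contributes the constant \<open>\<phi> (z\<^sup>k) + h (z\<^sup>k)\<close>, which cancels because it is finite.\<close>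

lemma y_step_min:
  assumes "\<phi> (z k) < \<infinity>"
  shows "\<theta> (y (Suc k)) + ereal (g (y (Suc k)) + x k \<bullet> (As (y (Suc k)) + (Bs (z k) - c))
             + \<sigma> / 2 * (norm (As (y (Suc k)) + (Bs (z k) - c)))\<^sup>2
             + 1 / 2 * ((y (Suc k) - y k) \<bullet> S (y (Suc k) - y k)))
       \<le> \<theta> w + ereal (g w + x k \<bullet> (As w + (Bs (z k) - c))
             + \<sigma> / 2 * (norm (As w + (Bs (z k) - c)))\<^sup>2 + 1 / 2 * ((w - y k) \<bullet> S (w - y k)))"
proof -
  obtain s where s: "\<phi> (z k) = ereal s"
    using assms pcc_not_MInf[OF \<phi>, of "z k"] by (cases "\<phi> (z k)") auto
  have "aug_lagrangian \<sigma> \<theta> \<phi> g h A B c (y (Suc k)) (z k) (x k) + ereal (1 / 2 * (wnorm S (y (Suc k) - y k))\<^sup>2)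
     \<le> aug_lagrangian \<sigma> \<theta> \<phi> g h A B c w (z k) (x k) + ereal (1 / 2 * (wnorm S (w - y k))\<^sup>2)"
    using sequence by (auto simp: sPADMM_sequence_def is_arg_min_def not_less)
  then show ?thesis
    unfolding aug_lagrangian_def s wnorm_squared[OF S] add_diff_eq
    using pcc_not_MInf[OF \<theta>, of w] pcc_not_MInf[OF \<theta>, of "y (Suc k)"]
    by (cases "\<theta> w"; cases "\<theta> (y (Suc k))") (auto simp: algebra_simps)
qed

lemma z_step_min:
  assumes "\<theta> (y (Suc k)) < \<infinity>"
  shows "\<phi> (z (Suc k)) + ereal (h (z (Suc k)) + x k \<bullet> (Bs (z (Suc k)) + (As (y (Suc k)) - c))
             + \<sigma> / 2 * (norm (Bs (z (Suc k)) + (As (y (Suc k)) - c)))\<^sup>2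
             + 1 / 2 * ((z (Suc k) - z k) \<bullet> T (z (Suc k) - z k)))
       \<le> \<phi> w + ereal (h w + x k \<bullet> (Bs w + (As (y (Suc k)) - c))
             + \<sigma> / 2 * (norm (Bs w + (As (y (Suc k)) - c)))\<^sup>2 + 1 / 2 * ((w - z k) \<bullet> T (w - z k)))"
proof -
  obtain s where s: "\<theta> (y (Suc k)) = ereal s"
    using assms pcc_not_MInf[OF \<theta>, of "y (Suc k)"] by (cases "\<theta> (y (Suc k))") auto
  have eq: "As (y (Suc k)) + v - c = v + (As (y (Suc k)) - c)" for v by simp
  have "aug_lagrangian \<sigma> \<theta> \<phi> g h A B c (y (Suc k)) (z (Suc k)) (x k) + ereal (1 / 2 * (wnorm T (z (Suc k) - z k))\<^sup>2)
     \<le> aug_lagrangian \<sigma> \<theta> \<phi> g h A B c (y (Suc k)) w (x k) + ereal (1 / 2 * (wnorm T (w - z k))\<^sup>2)"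
    using sequence by (auto simp: sPADMM_sequence_def is_arg_min_def not_less)
  then show ?thesis
    unfolding aug_lagrangian_def s wnorm_squared[OF T] eq
    using pcc_not_MInf[OF \<phi>, of w] pcc_not_MInf[OF \<phi>, of "z (Suc k)"]
    by (cases "\<phi> w"; cases "\<phi> (z (Suc k))") (auto simp: algebra_simps)
qed

text \<open>Each subproblem value is at most the value at the previous iterate. Finiteness matters because
  a block at which the other function is infinite would make every point a minimizer.\<close>

lemma iterates_finite: "\<theta> (y k) < \<infinity> \<and> \<phi> (z k) < \<infinity>"
proof (induction k)
  case 0
  then show ?case using sequence by (simp add: sPADMM_sequence_def eff_dom_def)
next
  case (Suc k)
  have "\<theta> (y (Suc k)) < \<infinity>" using y_step_min[of k "y k"] Suc by auto
  moreover from this have "\<phi> (z (Suc k)) < \<infinity>" using z_step_min[of k "z k"] Suc by auto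
  ultimately show ?case by simp
qed

text \<open>Expressed through the new multiplier \<open>x\<^sup>k\<^sup>+\<^sup>1\<close>, the optimality condition becomes the KKT
  inclusion at \<open>u\<^sup>k\<^sup>+\<^sup>1\<close> with perturbations that vanish with the steps and the residual. The
  \<open>y\<close>-step has an additional term because it uses \<open>z\<^sup>k\<close> instead of \<open>z\<^sup>k\<^sup>+\<^sup>1\<close>.\<close>

lemma y_subgradient:
  "- (dg (y (Suc k)) + A (x (Suc k) + ((1 - \<tau>) * \<sigma>) *\<^sub>R res (Suc k) - \<sigma> *\<^sub>R Bs (z (Suc k) - z k))
      + S (y (Suc k) - y k)) \<in> subdifferential \<theta> (y (Suc k))"
proof -
  have "- (dg (y (Suc k)) + A (x k + \<sigma> *\<^sub>R (As (y (Suc k)) + (Bs (z k) - c))) + S (y (Suc k) - y k))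
      \<in> subdifferential \<theta> (y (Suc k))"
    using proximal_step_subgradient[OF \<theta> A S g(2) _ y_step_min] iterates_finite by blast
  moreover have "x k + \<sigma> *\<^sub>R (As (y (Suc k)) + (Bs (z k) - c))
      = x (Suc k) + ((1 - \<tau>) * \<sigma>) *\<^sub>R res (Suc k) - \<sigma> *\<^sub>R Bs (z (Suc k) - z k)"
    unfolding x_Suc by (simp add: res_def linear_simps algebra_simps)
  ultimately show ?thesis by simp
qed

lemma z_subgradient:
  "- (dh (z (Suc k)) + B (x (Suc k) + ((1 - \<tau>) * \<sigma>) *\<^sub>R res (Suc k)) + T (z (Suc k) - z k))
     \<in> subdifferential \<phi> (z (Suc k))"
proof -
  have "- (dh (z (Suc k)) + B (x k + \<sigma> *\<^sub>R (Bs (z (Suc k)) + (As (y (Suc k)) - c))) + T (z (Suc k) - z k))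
      \<in> subdifferential \<phi> (z (Suc k))"
    using proximal_step_subgradient[OF \<phi> B T h(2) _ z_step_min] iterates_finite by blast
  moreover have "x k + \<sigma> *\<^sub>R (Bs (z (Suc k)) + (As (y (Suc k)) - c))
      = x (Suc k) + ((1 - \<tau>) * \<sigma>) *\<^sub>R res (Suc k)"
    unfolding x_Suc by (simp add: res_def algebra_simps)
  ultimately show ?thesis by simp
qed

section \<open>The weighting operator\<close>

lemma M_inner:
  "(a, b, d) \<bullet> M (a', b', d') = a \<bullet> S a' + a \<bullet> \<Sigma>\<^sub>\<theta> a' + b \<bullet> T b' + b \<bullet> \<Sigma>\<^sub>\<phi> b' + \<sigma> * (Bs b \<bullet> Bs b')
     + inverse (\<tau> * \<sigma>) * (d \<bullet> d') + s_tau \<tau> * \<sigma> * ((As a + Bs b) \<bullet> (As a' + Bs b'))"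
proof -
  have "linear (E_star A B)"
    unfolding E_star_def
    by (rule linearI) (auto simp: linear_simps algebra_simps)
  from adjoint_clauses(1)[OF this]
  have E: "(a, b, d) \<bullet> E_op A B v = E_star A B (a, b, d) \<bullet> v" for v
    by (simp add: E_op_def)
  have "(a, b, d) \<bullet> M (a', b', d') = a \<bullet> (S a' + \<Sigma>\<^sub>\<theta> a') + b \<bullet> (T b' + \<Sigma>\<^sub>\<phi> b' + \<sigma> *\<^sub>R B (Bs b'))
     + d \<bullet> (inverse (\<tau> * \<sigma>) *\<^sub>R d') + (s_tau \<tau> * \<sigma>) * ((a, b, d) \<bullet> E_op A B (E_star A B (a', b', d')))"
    by (simp add: M_def M_op_def inner_add_right)
  moreover have "b \<bullet> B (Bs b') = Bs b \<bullet> Bs b'"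
    using B_inner[of "Bs b'" b] by (simp add: inner_commute)
  ultimately show ?thesis
    unfolding E by (simp add: E_star_def inner_add_right)
qed

lemma M_quadratic:
  "(a, b, d) \<bullet> M (a, b, d) = a \<bullet> S a + a \<bullet> \<Sigma>\<^sub>\<theta> a + b \<bullet> T b + b \<bullet> \<Sigma>\<^sub>\<phi> b + \<sigma> * (norm (Bs b))\<^sup>2
     + inverse (\<tau> * \<sigma>) * (norm d)\<^sup>2 + s_tau \<tau> * \<sigma> * (norm (As a + Bs b))\<^sup>2"
  by (simp add: M_inner dot_square_norm)

text \<open>Positivity of \<open>1 - \<tau> + min \<tau> (1 / \<tau>)\<close> is what the golden ratio bound on \<open>\<tau>\<close> means:
  for \<open>\<tau> > 1\<close> it reads \<open>\<tau>\<^sup>2 < \<tau> + 1\<close>.\<close>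

lemma t_tau_pos: "0 < t_tau \<tau>"
proof (cases "\<tau> \<le> 1")
  case True
  then have "min \<tau> (inverse \<tau>) = \<tau>"
    using \<tau>(1) one_le_inverse[of \<tau>] by (simp add: min_def)
  then show ?thesis by (simp add: t_tau_def)
next
  case False
  have "(2 * \<tau> - 1)\<^sup>2 < (sqrt 5)\<^sup>2"
    using \<tau> False by (intro power_strict_mono) auto
  then have "\<tau> * \<tau> < \<tau> + 1" by (simp add: power2_eq_square algebra_simps)
  then have "\<tau> - 1 < inverse \<tau>" using \<tau>(1) by (simp add: field_simps)
  then show ?thesis by (simp add: t_tau_def min_def)
qed

lemma min_tau: "min \<tau> (inverse \<tau>) \<le> 1"
  using \<tau>(1) by (cases "\<tau> \<le> 1") (auto simp: min_le_iff_disj field_simps)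

lemma s_tau_eq: "s_tau \<tau> = (1 - min \<tau> (inverse \<tau>)) + 2 * t_tau \<tau>"
  by (simp add: s_tau_def t_tau_def field_simps)

lemma s_tau_pos: "0 < s_tau \<tau>"
  using min_tau t_tau_pos by (simp add: s_tau_eq)

lemma M_psd: "psd M"
  unfolding psd_def
proof (intro conjI allI)
  have sym: "v \<bullet> M w = M v \<bullet> w" for v w :: "'y \<times> 'z \<times> 'x"
  proof -
    obtain a b d where v: "v = (a, b, d)" by (cases v) 
    obtain a' b' d' where w: "w = (a', b', d')" by (cases w) 
    have "v \<bullet> M w = w \<bullet> M v"
      unfolding v w M_inner
      using psd_inner[OF S, of a a'] psd_inner[OF T, of b b'] psd_inner[OF \<Sigma>\<theta>, of a a'] psd_inner[OF \<Sigma>\<phi>, of b b']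
      by (simp add: inner_commute)
    then show ?thesis by (simp add: inner_commute)
  qed
  show "self_adjoint M"
  proof (rule self_adjointI)
    show "linear M"
    proof (rule linearI)
      show "M (v + w) = M v + M w" for v w
        by (rule vector_eq_rdot[THEN iffD1]) (simp add: sym[symmetric] inner_add_left inner_commute[of "M _"])
      show "M (r *\<^sub>R v) = r *\<^sub>R M v" for r v
        by (rule vector_eq_rdot[THEN iffD1]) (simp add: sym[symmetric] inner_commute[of "M _"])
    qed
  qed (simp add: sym)
  fix v :: "'y \<times> 'z \<times> 'x"
  obtain a b d where v: "v = (a, b, d)" by (cases v) 
  show "0 \<le> v \<bullet> M v"
    unfolding v M_quadratic
    using psd_nonneg[OF S] psd_nonneg[OF T] psd_nonneg[OF \<Sigma>\<theta>] psd_nonneg[OF \<Sigma>\<phi>] \<sigma> \<tau> s_tau_pos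
    by (intro add_nonneg_nonneg mult_nonneg_nonneg) auto
qed

text \<open>Vanishing of the quadratic form gives \<open>B\<^sup>* b = 0\<close> and then \<open>A\<^sup>* a = 0\<close>, so the assumed positive
  definiteness of \<open>\<Sigma> + S + \<sigma> A A\<^sup>*\<close> and \<open>\<Sigma> + T + \<sigma> B B\<^sup>*\<close> applies to each block.\<close>

lemma M_definite:
  assumes "v \<bullet> M v = 0"
  shows "v = 0"
proof -
  obtain a b d where v: "v = (a, b, d)" by (cases v)
  have nonneg: "0 \<le> a \<bullet> S a" "0 \<le> a \<bullet> \<Sigma>\<^sub>\<theta> a" "0 \<le> b \<bullet> T b" "0 \<le> b \<bullet> \<Sigma>\<^sub>\<phi> b"
    "0 \<le> \<sigma> * (norm (Bs b))\<^sup>2" "0 \<le> inverse (\<tau> * \<sigma>) * (norm d)\<^sup>2"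
    "0 \<le> s_tau \<tau> * \<sigma> * (norm (As a + Bs b))\<^sup>2"
    using psd_nonneg[OF S] psd_nonneg[OF T] psd_nonneg[OF \<Sigma>\<theta>] psd_nonneg[OF \<Sigma>\<phi>] \<sigma> \<tau> s_tau_pos
    by (auto intro!: mult_nonneg_nonneg)
  have zero: "a \<bullet> S a = 0" "a \<bullet> \<Sigma>\<^sub>\<theta> a = 0" "b \<bullet> T b = 0" "b \<bullet> \<Sigma>\<^sub>\<phi> b = 0"
    "\<sigma> * (norm (Bs b))\<^sup>2 = 0" "inverse (\<tau> * \<sigma>) * (norm d)\<^sup>2 = 0"
    "s_tau \<tau> * \<sigma> * (norm (As a + Bs b))\<^sup>2 = 0"
    using assms nonneg unfolding v M_quadratic by linarith+
  have "d = 0" "Bs b = 0" "As a = 0" using zero \<sigma> \<tau> s_tau_pos by auto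
  have "b \<bullet> (\<Sigma>\<^sub>\<phi> b + T b + \<sigma> *\<^sub>R B (Bs b)) = 0"
    using zero B_inner[of "Bs b" b] \<open>Bs b = 0\<close> by (simp add: inner_add_right inner_commute)
  then have "b = 0" using posdef_z unfolding pos_def_def by (metis less_irrefl)
  have "a \<bullet> (\<Sigma>\<^sub>\<theta> a + S a + \<sigma> *\<^sub>R A (As a)) = 0"
    using zero A_inner[of "As a" a] \<open>As a = 0\<close> by (simp add: inner_add_right inner_commute)
  then have "a = 0" using posdef_y unfolding pos_def_def by (metis less_irrefl)
  with \<open>b = 0\<close> \<open>d = 0\<close> show ?thesis by (simp add: v zero_prod_def)
qed

section \<open>Descent of the merit function\<close>

definition "m = min \<tau> (4 * t_tau \<tau>)"

text \<open>The \<open>T\<close>-seminorm of the last step is part of the merit function because the comparison of two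
  successive \<open>z\<close>-subproblems produces the previous step with the same weight.\<close>

definition "merit p k = (u (Suc k) - p) \<bullet> M (u (Suc k) - p)
  + (z (Suc k) - z k) \<bullet> T (z (Suc k) - z k)"

definition "progress k = (y (Suc k) - y k) \<bullet> S (y (Suc k) - y k) + (z (Suc k) - z k) \<bullet> T (z (Suc k) - z k)
  + \<sigma> * (norm (Bs (z (Suc k) - z k)))\<^sup>2 + \<sigma> * (norm (res (Suc k)))\<^sup>2"

text \<open>The guaranteed decrease of the merit function. The seminorms of \<open>S\<close> and \<open>T\<close> enter with weight
  \<open>1\<close>; this extra \<open>T\<close>-part is what absorbs the \<open>z\<close>-step in the energy.\<close>

definition "gap k = (y (Suc k) - y k) \<bullet> S (y (Suc k) - y k) + (z (Suc k) - z k) \<bullet> T (z (Suc k) - z k)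
  + m * \<sigma> * (norm (Bs (z (Suc k) - z k)))\<^sup>2 + m * \<sigma> * (norm (res (Suc k)))\<^sup>2"

lemma m_pos: "0 < m"
  using \<tau>(1) t_tau_pos by (simp add: m_def)

lemma m_le_1: "m \<le> 1"
proof -
  have "4 * t_tau \<tau> \<le> 1" using min_tau \<tau>(1) by (auto simp: t_tau_def min_def field_simps)
  then show ?thesis by (simp add: m_def)
qed

text \<open>The weights in Young's inequality: \<open>1\<close> and \<open>1\<close> for \<open>\<tau> \<le> 1\<close>, \<open>1 / \<tau>\<close> and \<open>\<tau>\<close> for \<open>\<tau> > 1\<close>.
  In the second case the leftover \<open>1 - \<tau> (\<tau> - 1)\<close> equals \<open>8 \<tau> t\<^sub>\<tau>\<close>, which dominates \<open>4 t\<^sub>\<tau>\<close>.\<close>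

lemma relaxation_Young:
  fixes v w :: "'a::real_inner"
  shows "2 * (1 - \<tau>) * (v \<bullet> w) \<le> (1 - min \<tau> (inverse \<tau>)) * (norm v)\<^sup>2 + (1 - m) * (norm w)\<^sup>2"
proof (cases "\<tau> \<le> 1")
  case True
  then have mn: "min \<tau> (inverse \<tau>) = \<tau>"
    using \<tau>(1) one_le_inverse[of \<tau>] by (simp add: min_def)
  have "0 \<le> (norm (v - w))\<^sup>2" by simp
  then have "2 * (v \<bullet> w) \<le> (norm v)\<^sup>2 + (norm w)\<^sup>2"
    unfolding power2_norm_eq_inner by (simp add: inner_simps inner_commute)
  from mult_left_mono[OF this, of "1 - \<tau>"] True
  have "2 * (1 - \<tau>) * (v \<bullet> w) \<le> (1 - \<tau>) * (norm v)\<^sup>2 + (1 - \<tau>) * (norm w)\<^sup>2"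
    by (simp add: algebra_simps)
  also have "(1 - \<tau>) * (norm w)\<^sup>2 \<le> (1 - m) * (norm w)\<^sup>2"
    by (intro mult_right_mono) (auto simp: m_def)
  finally show ?thesis by (simp add: mn)
next
  case False
  then have mn: "min \<tau> (inverse \<tau>) = inverse \<tau>"
    using inverse_le_1_iff[of \<tau>] by (simp add: min_def)
  have t: "8 * t_tau \<tau> = 1 - \<tau> + inverse \<tau>" by (simp add: t_tau_def mn)
  have "m \<le> 8 * t_tau \<tau>" using t_tau_pos by (simp add: m_def min_le_iff_disj)
  also have "\<dots> \<le> \<tau> * (8 * t_tau \<tau>)" using False t_tau_pos by simp
  also have "\<dots> = 1 - \<tau> * (\<tau> - 1)" using \<tau>(1) unfolding t by (simp add: field_simps)
  finally have m: "\<tau> * (\<tau> - 1) \<le> 1 - m" by simp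
  have "0 \<le> (norm (v + \<tau> *\<^sub>R w))\<^sup>2" by simp
  then have "- 2 * \<tau> * (v \<bullet> w) \<le> (norm v)\<^sup>2 + \<tau>\<^sup>2 * (norm w)\<^sup>2"
    unfolding power2_norm_eq_inner by (simp add: inner_simps inner_commute power2_eq_square)
  from mult_left_mono[OF this, of "inverse \<tau> * (\<tau> - 1)"] False
  have "inverse \<tau> * (\<tau> - 1) * (- 2 * \<tau> * (v \<bullet> w))
      \<le> inverse \<tau> * (\<tau> - 1) * ((norm v)\<^sup>2 + \<tau>\<^sup>2 * (norm w)\<^sup>2)" by simp
  moreover have "inverse \<tau> * (\<tau> - 1) * (- 2 * \<tau> * i) = 2 * (1 - \<tau>) * i"
    "inverse \<tau> * (\<tau> - 1) * (n + \<tau>\<^sup>2 * n') = (1 - inverse \<tau>) * n + \<tau> * (\<tau> - 1) * n'" for i n n'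
    using \<tau>(1) by (simp_all add: field_simps power2_eq_square)
  ultimately have "2 * (1 - \<tau>) * (v \<bullet> w)
      \<le> (1 - inverse \<tau>) * (norm v)\<^sup>2 + \<tau> * (\<tau> - 1) * (norm w)\<^sup>2" by simp
  also have "\<tau> * (\<tau> - 1) * (norm w)\<^sup>2 \<le> (1 - m) * (norm w)\<^sup>2"
    using m by (intro mult_right_mono) auto
  finally show ?thesis by (simp add: mn)
qed

lemma y_monotone:
  assumes "(a, b, d) \<in> \<Omega>"
  shows "(y (Suc k) - a) \<bullet> \<Sigma>\<^sub>\<theta> (y (Suc k) - a)
    + (x (Suc k) - d + ((1 - \<tau>) * \<sigma>) *\<^sub>R res (Suc k) - \<sigma> *\<^sub>R Bs (z (Suc k) - z k)) \<bullet> As (y (Suc k) - a)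
    + (y (Suc k) - a) \<bullet> S (y (Suc k) - y k) \<le> 0"
proof -
  let ?e = "x (Suc k) - d + ((1 - \<tau>) * \<sigma>) *\<^sub>R res (Suc k) - \<sigma> *\<^sub>R Bs (z (Suc k) - z k)"
  have "- (dg a + A d) + dg a \<in> subdifferential (\<lambda>w. \<theta> w + ereal (g w)) a"
    using assms kkt_iff by (intro subdifferential_add_gradient[OF \<theta> g(1,2)]) auto
  from mono_\<theta>[OF this subdifferential_add_gradient[OF \<theta> g(1,2) y_subgradient[of k]]]
  have "(y (Suc k) - a) \<bullet> \<Sigma>\<^sub>\<theta> (y (Suc k) - a) \<le> (- A ?e - S (y (Suc k) - y k)) \<bullet> (y (Suc k) - a)"
    unfolding wnorm_squared[OF \<Sigma>\<theta>] by (simp add: linear_simps algebra_simps)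
  also have "\<dots> = - (A ?e \<bullet> (y (Suc k) - a)) - (y (Suc k) - a) \<bullet> S (y (Suc k) - y k)"
    by (simp only: inner_diff_left inner_minus_left inner_commute[of "S _"])
  finally show ?thesis unfolding A_inner by linarith
qed

lemma z_monotone:
  assumes "(a, b, d) \<in> \<Omega>"
  shows "(z (Suc k) - b) \<bullet> \<Sigma>\<^sub>\<phi> (z (Suc k) - b)
    + (x (Suc k) - d + ((1 - \<tau>) * \<sigma>) *\<^sub>R res (Suc k)) \<bullet> Bs (z (Suc k) - b)
    + (z (Suc k) - b) \<bullet> T (z (Suc k) - z k) \<le> 0"
proof -
  let ?e = "x (Suc k) - d + ((1 - \<tau>) * \<sigma>) *\<^sub>R res (Suc k)"
  have "- (dh b + B d) + dh b \<in> subdifferential (\<lambda>w. \<phi> w + ereal (h w)) b"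
    using assms kkt_iff by (intro subdifferential_add_gradient[OF \<phi> h(1,2)]) auto
  from mono_\<phi>[OF this subdifferential_add_gradient[OF \<phi> h(1,2) z_subgradient[of k]]]
  have "(z (Suc k) - b) \<bullet> \<Sigma>\<^sub>\<phi> (z (Suc k) - b) \<le> (- B ?e - T (z (Suc k) - z k)) \<bullet> (z (Suc k) - b)"
    unfolding wnorm_squared[OF \<Sigma>\<phi>] by (simp add: linear_simps algebra_simps)
  also have "\<dots> = - (B ?e \<bullet> (z (Suc k) - b)) - (z (Suc k) - b) \<bullet> T (z (Suc k) - z k)"
    by (simp only: inner_diff_left inner_minus_left inner_commute[of "T _"])
  finally show ?thesis unfolding B_inner by linarith
qed

text \<open>Monotonicity of the subdifferential of \<open>\<phi> + h\<close> between two consecutive iterates; the multiplier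
  updates combine to \<open>\<sigma> (r' - (1 - \<tau>) r)\<close>.\<close>

lemma z_successive:
  "\<sigma> * ((res (Suc (Suc k)) - (1 - \<tau>) *\<^sub>R res (Suc k)) \<bullet> Bs (z (Suc (Suc k)) - z (Suc k)))
     + (z (Suc (Suc k)) - z (Suc k)) \<bullet> T (z (Suc (Suc k)) - z (Suc k))
   \<le> (z (Suc (Suc k)) - z (Suc k)) \<bullet> T (z (Suc k) - z k)"
proof -
  let ?d = "z (Suc (Suc k)) - z (Suc k)" and ?e = "res (Suc (Suc k)) - (1 - \<tau>) *\<^sub>R res (Suc k)"
  have "0 \<le> (wnorm \<Sigma>\<^sub>\<phi> ?d)\<^sup>2" by simp
  also note mono_\<phi>[OF subdifferential_add_gradient[OF \<phi> h(1,2) z_subgradient[of k]]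
      subdifferential_add_gradient[OF \<phi> h(1,2) z_subgradient[of "Suc k"]]]
  finally have "0 \<le> (- B (\<sigma> *\<^sub>R ?e) - T ?d + T (z (Suc k) - z k)) \<bullet> ?d"
    unfolding x_Suc[of "Suc k"] by (simp add: linear_simps algebra_simps)
  also have "\<dots> = - (B (\<sigma> *\<^sub>R ?e) \<bullet> ?d) - ?d \<bullet> T ?d + ?d \<bullet> T (z (Suc k) - z k)"
    by (simp only: inner_diff_left inner_add_left inner_minus_left inner_commute[of "T _"])
  finally show ?thesis unfolding B_inner inner_scaleR_left by linarith
qed

text \<open>The cross terms of the two monotonicity inequalities, where \<open>e\<close>, \<open>e'\<close> are multiplier
  errors, \<open>p\<close>, \<open>w\<close> the two parts of the residual and \<open>\<delta>\<close> the last change of \<open>w\<close>.\<close>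

lemma cross_terms:
  fixes e e' p w \<delta> :: "'a::real_inner"
  assumes "e' = e + (\<tau> * \<sigma>) *\<^sub>R (p + w)"
  shows "2 * ((e' + ((1 - \<tau>) * \<sigma>) *\<^sub>R (p + w) - \<sigma> *\<^sub>R \<delta>) \<bullet> p + (e' + ((1 - \<tau>) * \<sigma>) *\<^sub>R (p + w)) \<bullet> w)
    = inverse (\<tau> * \<sigma>) * ((norm e')\<^sup>2 - (norm e)\<^sup>2) + (2 - \<tau>) * \<sigma> * (norm (p + w))\<^sup>2
      - 2 * \<sigma> * ((p + w) \<bullet> \<delta>) + \<sigma> * ((norm w)\<^sup>2 - (norm (w - \<delta>))\<^sup>2 + (norm \<delta>)\<^sup>2)"
proof -
  define r where "r = p + w"
  have "(norm e')\<^sup>2 - (norm e)\<^sup>2 = (\<tau> * \<sigma>) * (2 * (e' \<bullet> r) - \<tau> * \<sigma> * (norm r)\<^sup>2)"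
    unfolding assms r_def[symmetric] power2_norm_eq_inner
    by (simp add: inner_simps inner_commute algebra_simps)
  then have 1: "inverse (\<tau> * \<sigma>) * ((norm e')\<^sup>2 - (norm e)\<^sup>2) = 2 * (e' \<bullet> r) - \<tau> * \<sigma> * (norm r)\<^sup>2"
    using \<tau>(1) \<sigma> by (simp del: inverse_mult_distrib)
  have p: "p = r - w" by (simp add: r_def)
  show ?thesis
    unfolding 1[unfolded r_def] r_def[symmetric] unfolding p power2_norm_eq_inner
    by (simp add: inner_simps inner_commute algebra_simps)
qed

text \<open>The sum of \<open>y_monotone\<close> and \<open>z_monotone\<close>, with polarization of the proximal terms, telescopes up
  to the cross term between the new residual and the \<open>z\<close>-step. That term is moved to the previous
  residual by \<open>z_successive\<close> and then split by \<open>relaxation_Young\<close>; the weight \<open>s\<^sub>\<tau>\<close> of the residual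
  in \<open>M\<close> is chosen so that its previous value is paid for.\<close>

lemma descent:
  assumes p: "p \<in> \<Omega>"
  shows "merit p (Suc k) + gap (Suc k) \<le> merit p k"
proof -
  obtain a b d where abd: "p = (a, b, d)" by (cases p)
  define y0 y1 z0 z1 z' where "y0 = y (Suc k)" "y1 = y (Suc (Suc k))" "z0 = z (Suc k)"
    "z1 = z (Suc (Suc k))" "z' = z k"
  note seq = this
  define r0 r1 where "r0 = res (Suc k)" "r1 = res (Suc (Suc k))"
  note r = this
  define e0 e1 where "e0 = x (Suc k) - d" "e1 = x (Suc (Suc k)) - d"
  note e = this
  define \<delta> where "\<delta> = Bs (z1 - z0)"
  define mn where "mn = min \<tau> (inverse \<tau>)"
  have c: "As a + Bs b = c" using p kkt_iff abd by simp
  have res1: "r1 = As (y1 - a) + Bs (z1 - b)" and res0: "r0 = As (y0 - a) + Bs (z0 - b)"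
  proof -
    have "v + w - c = (v - As a) + (w - Bs b)" for v w
      unfolding c[symmetric] by simp
    then show "r1 = As (y1 - a) + Bs (z1 - b)" "r0 = As (y0 - a) + Bs (z0 - b)"
      unfolding r res_def seq by (simp_all only: linear_simps)
  qed
  have e1: "e1 = e0 + (\<tau> * \<sigma>) *\<^sub>R (As (y1 - a) + Bs (z1 - b))"
    unfolding res1[symmetric] by (simp add: e r x_Suc[of "Suc k"])
  have w: "Bs (z1 - b) - \<delta> = Bs (z0 - b)" by (simp add: \<delta>_def linear_simps)
  have I: "2 * ((y1 - a) \<bullet> \<Sigma>\<^sub>\<theta> (y1 - a)) + 2 * ((z1 - b) \<bullet> \<Sigma>\<^sub>\<phi> (z1 - b))
     + (inverse (\<tau> * \<sigma>) * ((norm e1)\<^sup>2 - (norm e0)\<^sup>2) + (2 - \<tau>) * \<sigma> * (norm r1)\<^sup>2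
      - 2 * \<sigma> * (r1 \<bullet> \<delta>) + \<sigma> * ((norm (Bs (z1 - b)))\<^sup>2 - (norm (Bs (z0 - b)))\<^sup>2 + (norm \<delta>)\<^sup>2))
     + 2 * ((y1 - a) \<bullet> S (y1 - y0)) + 2 * ((z1 - b) \<bullet> T (z1 - z0)) \<le> 0"
  proof -
    have add: "2 * a1 + 2 * a2 + C + 2 * s1 + 2 * s2 \<le> 0"
      if "a1 + c1 + s1 \<le> 0" "a2 + c2 + s2 \<le> 0" "2 * (c1 + c2) = C" for a1 a2 c1 c2 C s1 s2 :: real
      using that unfolding distrib_left by linarith
    show ?thesis
      using add[OF y_monotone[OF p[unfolded abd], of "Suc k"] z_monotone[OF p[unfolded abd], of "Suc k"]]
        cross_terms[OF e1, of \<delta>, unfolded w]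
      unfolding seq[symmetric] r[symmetric] e[symmetric] \<delta>_def[symmetric] res1[symmetric]
      by blast
  qed
  have II: "2 * \<sigma> * (r1 \<bullet> \<delta>) \<le> \<sigma> * (2 * (1 - \<tau>) * (r0 \<bullet> \<delta>)) - 2 * ((z1 - z0) \<bullet> T (z1 - z0))
      + 2 * ((z1 - z0) \<bullet> T (z0 - z'))"
    using z_successive[of k] unfolding seq[symmetric] r[symmetric] \<delta>_def[symmetric]
    by (simp add: inner_diff_left algebra_simps)
  have III: "\<sigma> * (2 * (1 - \<tau>) * (r0 \<bullet> \<delta>)) \<le> \<sigma> * ((1 - mn) * (norm r0)\<^sup>2 + (1 - m) * (norm \<delta>)\<^sup>2)"
    unfolding mn_def using \<sigma> by (intro mult_left_mono relaxation_Young) auto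
  have IV: "2 * ((z1 - z0) \<bullet> T (z0 - z')) \<le> (z1 - z0) \<bullet> T (z1 - z0) + (z0 - z') \<bullet> T (z0 - z')"
    by (rule psd_Young[OF T])
  have pos: "0 \<le> (y0 - a) \<bullet> \<Sigma>\<^sub>\<theta> (y0 - a)" "0 \<le> (y1 - a) \<bullet> \<Sigma>\<^sub>\<theta> (y1 - a)"
    "0 \<le> (z0 - b) \<bullet> \<Sigma>\<^sub>\<phi> (z0 - b)" "0 \<le> (z1 - b) \<bullet> \<Sigma>\<^sub>\<phi> (z1 - b)"
    by (simp_all add: psd_nonneg \<Sigma>\<theta> \<Sigma>\<phi>)
  have q: "(u (Suc k) - p) \<bullet> M (u (Suc k) - p)
      = (y0 - a) \<bullet> S (y0 - a) + (y0 - a) \<bullet> \<Sigma>\<^sub>\<theta> (y0 - a) + (z0 - b) \<bullet> T (z0 - b) + (z0 - b) \<bullet> \<Sigma>\<^sub>\<phi> (z0 - b)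
        + \<sigma> * (norm (Bs (z0 - b)))\<^sup>2 + inverse (\<tau> * \<sigma>) * (norm e0)\<^sup>2 + s_tau \<tau> * \<sigma> * (norm r0)\<^sup>2"
    "(u (Suc (Suc k)) - p) \<bullet> M (u (Suc (Suc k)) - p)
      = (y1 - a) \<bullet> S (y1 - a) + (y1 - a) \<bullet> \<Sigma>\<^sub>\<theta> (y1 - a) + (z1 - b) \<bullet> T (z1 - b) + (z1 - b) \<bullet> \<Sigma>\<^sub>\<phi> (z1 - b)
        + \<sigma> * (norm (Bs (z1 - b)))\<^sup>2 + inverse (\<tau> * \<sigma>) * (norm e1)\<^sup>2 + s_tau \<tau> * \<sigma> * (norm r1)\<^sup>2"
    by (simp_all only: u_def abd diff_Pair M_quadratic seq e res0 res1)
  have t: "8 * t_tau \<tau> = 1 - \<tau> + mn" by (simp add: t_tau_def mn_def)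
  have s: "s_tau \<tau> = (1 - mn) + 2 * t_tau \<tau>" by (simp add: s_tau_eq mn_def)
  have R0: "0 \<le> t_tau \<tau> * \<sigma> * (norm r0)\<^sup>2" using t_tau_pos \<sigma> by simp
  have "m \<le> 6 * t_tau \<tau>" using t_tau_pos by (simp add: m_def min_le_iff_disj)
  then have R1: "m * \<sigma> * (norm r1)\<^sup>2 \<le> 6 * t_tau \<tau> * \<sigma> * (norm r1)\<^sup>2"
    using \<sigma> by (intro mult_right_mono) auto
  \<comment> \<open>Of the coefficient of the new squared residual, \<open>s\<^sub>\<tau>\<close> goes into the merit function and
    \<open>6 t\<^sub>\<tau> \<ge> m\<close> is left for the gap.\<close>
  have "2 - \<tau> = s_tau \<tau> + 6 * t_tau \<tau>" using t s by linarith
  then have R1': "(2 - \<tau>) * \<sigma> * (norm r1)\<^sup>2 = s_tau \<tau> * \<sigma> * (norm r1)\<^sup>2 + 6 * t_tau \<tau> * \<sigma> * (norm r1)\<^sup>2"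
    by (simp only: distrib_right)
  have R0': "s_tau \<tau> * \<sigma> * (norm r0)\<^sup>2 = \<sigma> * ((1 - mn) * (norm r0)\<^sup>2) + 2 * (t_tau \<tau> * \<sigma> * (norm r0)\<^sup>2)"
    unfolding s by (simp add: algebra_simps)
  have D: "\<sigma> * ((1 - mn) * (norm r0)\<^sup>2 + (1 - m) * (norm \<delta>)\<^sup>2)
      = \<sigma> * ((1 - mn) * (norm r0)\<^sup>2) + \<sigma> * (norm \<delta>)\<^sup>2 - m * \<sigma> * (norm \<delta>)\<^sup>2"
    by (simp add: algebra_simps)
  have goal: "merit p (Suc k) + gap (Suc k) - merit p k =
      (y1 - a) \<bullet> S (y1 - a) + (y1 - a) \<bullet> \<Sigma>\<^sub>\<theta> (y1 - a) + (z1 - b) \<bullet> T (z1 - b) + (z1 - b) \<bullet> \<Sigma>\<^sub>\<phi> (z1 - b)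
        + \<sigma> * (norm (Bs (z1 - b)))\<^sup>2 + inverse (\<tau> * \<sigma>) * (norm e1)\<^sup>2 + s_tau \<tau> * \<sigma> * (norm r1)\<^sup>2
      + (z1 - z0) \<bullet> T (z1 - z0)
      + ((y1 - y0) \<bullet> S (y1 - y0) + (z1 - z0) \<bullet> T (z1 - z0) + m * \<sigma> * (norm \<delta>)\<^sup>2 + m * \<sigma> * (norm r1)\<^sup>2)
      - ((y0 - a) \<bullet> S (y0 - a) + (y0 - a) \<bullet> \<Sigma>\<^sub>\<theta> (y0 - a) + (z0 - b) \<bullet> T (z0 - b) + (z0 - b) \<bullet> \<Sigma>\<^sub>\<phi> (z0 - b)
        + \<sigma> * (norm (Bs (z0 - b)))\<^sup>2 + inverse (\<tau> * \<sigma>) * (norm e0)\<^sup>2 + s_tau \<tau> * \<sigma> * (norm r0)\<^sup>2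
        + (z0 - z') \<bullet> T (z0 - z'))"
    unfolding merit_def gap_def q unfolding seq r \<delta>_def by simp
  have "merit p (Suc k) + gap (Suc k) - merit p k \<le> 0"
    using I II III[unfolded D] IV pos R0 R1
    unfolding goal R1' R0' psd_polarization[OF S, of y1 a y0] psd_polarization[OF T, of z1 b z0]
      right_diff_distrib distrib_left[of \<sigma>]
    by linarith
  then show ?thesis by simp
qed

text \<open>By \<open>prox_residual_le\<close> each block of the KKT residual is bounded by the perturbation in its
  subgradient. The perturbation of the \<open>y\<close>-block has three summands and that of the \<open>z\<close>-block two,
  which is where the factors \<open>3\<close> and \<open>2\<close> in \<open>\<kappa>\<close> come from.\<close>

lemma residual_bound:
  "(norm (kkt_map \<theta> \<phi> dg dh A B c (u (Suc k))))\<^sup>2 \<le> kappa \<sigma> \<tau> S T A B * progress k"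
proof -
  define Y Z X where "Y = y (Suc k)" "Z = z (Suc k)" "X = x (Suc k)"
  note YZX = this
  define r dy dz where "r = res (Suc k)" "dy = y (Suc k) - y k" "dz = z (Suc k) - z k"
  note rd = this
  define \<kappa> where "\<kappa> = kappa \<sigma> \<tau> S T A B"
  define lA lB where "lA = lambda_max (A \<circ> As)" "lB = lambda_max (B \<circ> Bs)"
  note l = this
  have l0: "0 \<le> lA" "0 \<le> lB" using lambda_max_nonneg psd_gram A B by (auto simp: l)
  have k1: "3 * onorm S \<le> \<kappa>" and k2: "3 * \<sigma> * lA \<le> \<kappa>" and k2': "2 * onorm T \<le> \<kappa>"
    and k3: "3 * (1 - \<tau>)\<^sup>2 * \<sigma> * lA + 2 * (1 - \<tau>)\<^sup>2 * \<sigma> * lB + inverse \<sigma> \<le> \<kappa>"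
    by (simp_all add: \<kappa>_def kappa_def Let_def l)
  have three: "(norm (v1 + v2 + v3))\<^sup>2 \<le> 3 * (norm v1)\<^sup>2 + 3 * (norm v2)\<^sup>2 + 3 * (norm v3)\<^sup>2" for v1 v2 v3 :: 'y
    using zero_le_power2[of "norm (v1 - v2)"] zero_le_power2[of "norm (v1 - v3)"] zero_le_power2[of "norm (v2 - v3)"]
    unfolding power2_norm_eq_inner by (simp add: inner_simps inner_commute)
  have two: "(norm (v1 + v2))\<^sup>2 \<le> 2 * (norm v1)\<^sup>2 + 2 * (norm v2)\<^sup>2" for v1 v2 :: 'z
    using zero_le_power2[of "norm (v1 - v2)"]
    unfolding power2_norm_eq_inner by (simp add: inner_simps inner_commute)
  have "norm (Y - prox \<theta> (Y - (dg Y + A X))) \<le> norm (A (((1 - \<tau>) * \<sigma>) *\<^sub>R r) + A (- (\<sigma> *\<^sub>R Bs dz)) + S dy)"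
  proof -
    have "norm (Y - prox \<theta> (Y - (dg Y + A X)))
        \<le> norm (- (dg Y + A (X + ((1 - \<tau>) * \<sigma>) *\<^sub>R r - \<sigma> *\<^sub>R Bs dz) + S dy) + (dg Y + A X))"
      unfolding YZX rd by (rule prox_residual_le[OF \<theta> y_subgradient])
    also have "- (dg Y + A (X + ((1 - \<tau>) * \<sigma>) *\<^sub>R r - \<sigma> *\<^sub>R Bs dz) + S dy) + (dg Y + A X)
        = - (A (((1 - \<tau>) * \<sigma>) *\<^sub>R r) + A (- (\<sigma> *\<^sub>R Bs dz)) + S dy)"
      by (simp add: linear_simps)
    finally show ?thesis by (simp only: norm_minus_cancel)
  qed
  from power_mono[OF this norm_ge_zero, of 2]
  have "(norm (Y - prox \<theta> (Y - (dg Y + A X))))\<^sup>2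
      \<le> 3 * (norm (A (((1 - \<tau>) * \<sigma>) *\<^sub>R r)))\<^sup>2 + 3 * (norm (A (- (\<sigma> *\<^sub>R Bs dz))))\<^sup>2 + 3 * (norm (S dy))\<^sup>2"
    using three order_trans by blast
  also have "\<dots> \<le> 3 * (lA * (norm (((1 - \<tau>) * \<sigma>) *\<^sub>R r))\<^sup>2) + 3 * (lA * (norm (- (\<sigma> *\<^sub>R Bs dz)))\<^sup>2)
      + 3 * (onorm S * (dy \<bullet> S dy))"
    unfolding l by (intro add_mono mult_left_mono norm_image_le_lambda_max[OF A] psd_norm_image_le[OF S]) auto
  also have "\<dots> = (3 * (1 - \<tau>)\<^sup>2 * \<sigma> * lA) * (\<sigma> * (norm r)\<^sup>2) + (3 * \<sigma> * lA) * (\<sigma> * (norm (Bs dz))\<^sup>2)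
      + (3 * onorm S) * (dy \<bullet> S dy)"
    by (simp add: power_mult_distrib) (simp add: power2_eq_square)
  finally have RY: "(norm (Y - prox \<theta> (Y - (dg Y + A X))))\<^sup>2 \<le> \<dots>" .
  have "norm (Z - prox \<phi> (Z - (dh Z + B X))) \<le> norm (B (((1 - \<tau>) * \<sigma>) *\<^sub>R r) + T dz)"
  proof -
    have "norm (Z - prox \<phi> (Z - (dh Z + B X)))
        \<le> norm (- (dh Z + B (X + ((1 - \<tau>) * \<sigma>) *\<^sub>R r) + T dz) + (dh Z + B X))"
      unfolding YZX rd by (rule prox_residual_le[OF \<phi> z_subgradient])
    also have "- (dh Z + B (X + ((1 - \<tau>) * \<sigma>) *\<^sub>R r) + T dz) + (dh Z + B X)
        = - (B (((1 - \<tau>) * \<sigma>) *\<^sub>R r) + T dz)"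
      by (simp add: linear_simps)
    finally show ?thesis by (simp only: norm_minus_cancel)
  qed
  from power_mono[OF this norm_ge_zero, of 2]
  have "(norm (Z - prox \<phi> (Z - (dh Z + B X))))\<^sup>2
      \<le> 2 * (norm (B (((1 - \<tau>) * \<sigma>) *\<^sub>R r)))\<^sup>2 + 2 * (norm (T dz))\<^sup>2"
    using two order_trans by blast
  also have "\<dots> \<le> 2 * (lB * (norm (((1 - \<tau>) * \<sigma>) *\<^sub>R r))\<^sup>2) + 2 * (onorm T * (dz \<bullet> T dz))"
    unfolding l by (intro add_mono mult_left_mono norm_image_le_lambda_max[OF B] psd_norm_image_le[OF T]) auto
  also have "\<dots> = (2 * (1 - \<tau>)\<^sup>2 * \<sigma> * lB) * (\<sigma> * (norm r)\<^sup>2) + (2 * onorm T) * (dz \<bullet> T dz)"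
    by (simp add: power_mult_distrib) (simp add: power2_eq_square)
  finally have RZ: "(norm (Z - prox \<phi> (Z - (dh Z + B X))))\<^sup>2 \<le> \<dots>" .
  have "c - As Y - Bs Z = - r" by (simp add: rd YZX res_def)
  then have RX: "(norm (c - As Y - Bs Z))\<^sup>2 = inverse \<sigma> * (\<sigma> * (norm r)\<^sup>2)"
    using \<sigma> by simp
  have "(norm (kkt_map \<theta> \<phi> dg dh A B c (u (Suc k))))\<^sup>2
      = (norm (Y - prox \<theta> (Y - (dg Y + A X))))\<^sup>2 + (norm (Z - prox \<phi> (Z - (dh Z + B X))))\<^sup>2
        + (norm (c - As Y - Bs Z))\<^sup>2"
    by (simp add: kkt_map_def u_def YZX power2_norm_eq_inner)
  also have "\<dots> \<le> (3 * onorm S) * (dy \<bullet> S dy) + (2 * onorm T) * (dz \<bullet> T dz)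
      + (3 * \<sigma> * lA) * (\<sigma> * (norm (Bs dz))\<^sup>2)
      + (3 * (1 - \<tau>)\<^sup>2 * \<sigma> * lA + 2 * (1 - \<tau>)\<^sup>2 * \<sigma> * lB + inverse \<sigma>) * (\<sigma> * (norm r)\<^sup>2)"
    using RY RZ unfolding RX distrib_right by linarith
  also have "\<dots> \<le> \<kappa> * (dy \<bullet> S dy) + \<kappa> * (dz \<bullet> T dz) + \<kappa> * (\<sigma> * (norm (Bs dz))\<^sup>2) + \<kappa> * (\<sigma> * (norm r)\<^sup>2)"
    using \<sigma> by (intro add_mono mult_right_mono k1 k2 k2' k3 psd_nonneg S T) auto
  also have "\<dots> = \<kappa> * progress k"
    by (simp add: progress_def rd distrib_left)
  finally show ?thesis by (simp add: \<kappa>_def)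
qed

section \<open>Convergence of the iterates\<close>

lemma progress_parts:
  "0 \<le> (y (Suc k) - y k) \<bullet> S (y (Suc k) - y k)" "0 \<le> (z (Suc k) - z k) \<bullet> T (z (Suc k) - z k)"
  "0 \<le> \<sigma> * (norm (Bs (z (Suc k) - z k)))\<^sup>2" "0 \<le> \<sigma> * (norm (res (Suc k)))\<^sup>2"
  using \<sigma> by (auto simp: psd_nonneg S T)

lemma gap_ge: "m * progress k \<le> gap k" "(z (Suc k) - z k) \<bullet> T (z (Suc k) - z k) \<le> gap k" "0 \<le> gap k"
proof -
  have eq: "gap k = (y (Suc k) - y k) \<bullet> S (y (Suc k) - y k) + (z (Suc k) - z k) \<bullet> T (z (Suc k) - z k)
     + m * (\<sigma> * (norm (Bs (z (Suc k) - z k)))\<^sup>2) + m * (\<sigma> * (norm (res (Suc k)))\<^sup>2)"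
    by (simp add: gap_def)
  show "m * progress k \<le> gap k"
    unfolding progress_def eq distrib_left using progress_parts[of k] m_le_1 m_pos
    by (intro add_mono order_refl mult_left_le_one_le) auto
  have nn: "0 \<le> m * (\<sigma> * (norm (Bs (z (Suc k) - z k)))\<^sup>2)" "0 \<le> m * (\<sigma> * (norm (res (Suc k)))\<^sup>2)"
    by (rule mult_nonneg_nonneg[OF less_imp_le[OF m_pos] progress_parts(3)],
        rule mult_nonneg_nonneg[OF less_imp_le[OF m_pos] progress_parts(4)])
  show "(z (Suc k) - z k) \<bullet> T (z (Suc k) - z k) \<le> gap k"
    unfolding eq using progress_parts(1,2)[of k] nn by linarith
  show "0 \<le> gap k"
    unfolding eq using progress_parts(1,2)[of k] nn by linarith
qed

lemma norm_steps_le_progress: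
  "(norm (res (Suc k)))\<^sup>2 \<le> inverse \<sigma> * progress k"
  "(norm (Bs (z (Suc k) - z k)))\<^sup>2 \<le> inverse \<sigma> * progress k"
  "(norm (S (y (Suc k) - y k)))\<^sup>2 \<le> onorm S * progress k"
  "(norm (T (z (Suc k) - z k)))\<^sup>2 \<le> onorm T * progress k"
proof -
  note p = progress_parts[of k]
  have "\<sigma> * (norm (res (Suc k)))\<^sup>2 \<le> progress k" "\<sigma> * (norm (Bs (z (Suc k) - z k)))\<^sup>2 \<le> progress k"
    unfolding progress_def using p by linarith+
  then show "(norm (res (Suc k)))\<^sup>2 \<le> inverse \<sigma> * progress k"
    "(norm (Bs (z (Suc k) - z k)))\<^sup>2 \<le> inverse \<sigma> * progress k"
    using \<sigma> by (simp_all add: field_simps)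
  have "(y (Suc k) - y k) \<bullet> S (y (Suc k) - y k) \<le> progress k"
    "(z (Suc k) - z k) \<bullet> T (z (Suc k) - z k) \<le> progress k"
    unfolding progress_def using p by linarith+
  then show "(norm (S (y (Suc k) - y k)))\<^sup>2 \<le> onorm S * progress k"
    "(norm (T (z (Suc k) - z k)))\<^sup>2 \<le> onorm T * progress k"
    using psd_norm_image_le[OF S, of "y (Suc k) - y k"] psd_norm_image_le[OF T, of "z (Suc k) - z k"]
      psd_linear[OF S] psd_linear[OF T]
    by (meson linear_conv_bounded_linear mult_left_mono onorm_pos_le order_trans)+
qed

lemma merit_nonneg: "0 \<le> merit p k"
  by (simp add: merit_def psd_nonneg M_psd T)

lemma merit_decseq:
  assumes "p \<in> \<Omega>"
  shows "decseq (merit p)"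
proof (rule decseq_SucI)
  show "merit p (Suc k) \<le> merit p k" for k
    using descent[OF assms, of k] gap_ge(3)[of "Suc k"] by linarith
qed

lemma merit_converges:
  assumes "p \<in> \<Omega>"
  obtains l where "merit p \<longlonglongrightarrow> l"
proof -
  have "\<forall>k. 0 \<le> merit p k" by (simp add: merit_nonneg)
  from decseq_convergent[OF merit_decseq[OF assms] this] that show thesis by metis
qed

lemma gap_tendsto_0:
  assumes "p \<in> \<Omega>"
  shows "gap \<longlonglongrightarrow> 0"
proof -
  obtain l where l: "merit p \<longlonglongrightarrow> l" using merit_converges[OF assms] .
  have "(\<lambda>k. merit p k - merit p (Suc k)) \<longlonglongrightarrow> l - l"
    by (intro tendsto_diff l LIMSEQ_Suc)
  then have lim: "(\<lambda>k. merit p k - merit p (Suc k)) \<longlonglongrightarrow> 0" by simp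
  have upper: "gap (Suc k) \<le> merit p k - merit p (Suc k)" for k
    using descent[OF assms, of k] by linarith
  have "(\<lambda>k. gap (Suc k)) \<longlonglongrightarrow> 0"
    by (rule tendsto_sandwich[OF _ _ tendsto_const lim])
       (simp_all only: gap_ge(3) upper eventually_True)
  then show ?thesis by (simp only: filterlim_sequentially_Suc)
qed

lemma progress_tendsto_0:
  assumes "p \<in> \<Omega>"
  shows "progress \<longlonglongrightarrow> 0"
proof -
  have lim: "(\<lambda>k. inverse m * gap k) \<longlonglongrightarrow> 0"
    by (rule tendsto_mult_right_zero[OF gap_tendsto_0[OF assms]])
  have le: "0 \<le> progress k" "progress k \<le> inverse m * gap k" for k
    using progress_parts[of k] gap_ge(1)[of k] m_pos by (simp_all add: progress_def field_simps)
  show ?thesis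
    by (rule tendsto_sandwich[OF _ _ tendsto_const lim]) (simp_all only: le eventually_True)
qed

lemma tendsto_0_if_le_progress:
  fixes f :: "nat \<Rightarrow> 'a::real_normed_vector"
  assumes "p \<in> \<Omega>" "\<And>k. (norm (f k))\<^sup>2 \<le> K * progress k"
  shows "f \<longlonglongrightarrow> 0"
proof -
  have "(\<lambda>k. sqrt (K * progress k)) \<longlonglongrightarrow> sqrt (K * 0)"
    by (intro tendsto_intros progress_tendsto_0[OF assms(1)])
  then have lim: "(\<lambda>k. sqrt (K * progress k)) \<longlonglongrightarrow> 0" by simp
  have le: "norm (f k) \<le> sqrt (K * progress k)" for k
    using assms(2)[of k] by (rule real_le_rsqrt)
  show ?thesis
    by (rule Lim_null_comparison[OF _ lim]) (simp only: le eventually_True)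
qed

text \<open>In the limit the perturbation terms in the subgradients of \<open>y_subgradient\<close> and
  \<open>z_subgradient\<close> disappear, and what remains is the KKT system.\<close>

lemma cluster_point_kkt:
  assumes \<Omega>: "p \<in> \<Omega>" and f: "strict_mono f" and lim: "(\<lambda>n. u (Suc (f n))) \<longlonglongrightarrow> (a, b, d)"
  shows "(a, b, d) \<in> \<Omega>"
proof -
  have sub: "(\<lambda>n. v (f n)) \<longlonglongrightarrow> l" if "v \<longlonglongrightarrow> l" for v :: "nat \<Rightarrow> 'b::topological_space" and l
    using LIMSEQ_subseq_LIMSEQ[OF that f] by (simp add: comp_def)
  have yl: "(\<lambda>n. y (Suc (f n))) \<longlonglongrightarrow> a" and zl: "(\<lambda>n. z (Suc (f n))) \<longlonglongrightarrow> b"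
    and xl: "(\<lambda>n. x (Suc (f n))) \<longlonglongrightarrow> d"
    using tendsto_fst[OF lim] tendsto_fst[OF tendsto_snd[OF lim]] tendsto_snd[OF tendsto_snd[OF lim]]
    by (simp_all add: u_def)
  note t0 = tendsto_0_if_le_progress[OF \<Omega>, THEN LIMSEQ_subseq_LIMSEQ[OF _ f], unfolded comp_def]
  have r0: "(\<lambda>n. res (Suc (f n))) \<longlonglongrightarrow> 0" by (rule t0[OF norm_steps_le_progress(1)])
  have B0: "(\<lambda>n. Bs (z (Suc (f n)) - z (f n))) \<longlonglongrightarrow> 0" by (rule t0[OF norm_steps_le_progress(2)])
  have S0: "(\<lambda>n. S (y (Suc (f n)) - y (f n))) \<longlonglongrightarrow> 0" by (rule t0[OF norm_steps_le_progress(3)])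
  have T0: "(\<lambda>n. T (z (Suc (f n)) - z (f n))) \<longlonglongrightarrow> 0" by (rule t0[OF norm_steps_le_progress(4)])
  have bl: "bounded_linear A" "bounded_linear B" "bounded_linear As" "bounded_linear Bs"
    using A B As_linear Bs_linear by (simp_all add: linear_conv_bounded_linear)
  have dgl: "(\<lambda>n. dg (y (Suc (f n)))) \<longlonglongrightarrow> dg a" and dhl: "(\<lambda>n. dh (z (Suc (f n)))) \<longlonglongrightarrow> dh b"
    using g(3) h(3) yl zl by (auto simp: continuous_on_eq_continuous_at intro: isCont_tendsto_compose)
  have "(\<lambda>n. - (dg (y (Suc (f n))) + A (x (Suc (f n)) + ((1 - \<tau>) * \<sigma>) *\<^sub>R res (Suc (f n))
          - \<sigma> *\<^sub>R Bs (z (Suc (f n)) - z (f n))) + S (y (Suc (f n)) - y (f n))))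
      \<longlonglongrightarrow> - (dg a + A (d + ((1 - \<tau>) * \<sigma>) *\<^sub>R 0 - \<sigma> *\<^sub>R 0) + 0)"
    by (intro tendsto_intros bounded_linear.tendsto[OF bl(1)] dgl xl r0 B0 S0)
  from subdifferential_closed_graph[OF \<theta> y_subgradient this yl]
  have 1: "- (dg a + A d) \<in> subdifferential \<theta> a" by simp
  have "(\<lambda>n. - (dh (z (Suc (f n))) + B (x (Suc (f n)) + ((1 - \<tau>) * \<sigma>) *\<^sub>R res (Suc (f n)))
          + T (z (Suc (f n)) - z (f n))))
      \<longlonglongrightarrow> - (dh b + B (d + ((1 - \<tau>) * \<sigma>) *\<^sub>R 0) + 0)"
    by (intro tendsto_intros bounded_linear.tendsto[OF bl(2)] dhl xl r0 T0)
  from subdifferential_closed_graph[OF \<phi> z_subgradient this zl]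
  have 2: "- (dh b + B d) \<in> subdifferential \<phi> b" by simp
  have "(\<lambda>n. res (Suc (f n))) \<longlonglongrightarrow> As a + Bs b - c"
    unfolding res_def
    by (intro tendsto_intros bounded_linear.tendsto[OF bl(3)] bounded_linear.tendsto[OF bl(4)] yl zl)
  from LIMSEQ_unique[OF this r0] have 3: "As a + Bs b = c" by simp
  show ?thesis using 1 2 3 kkt_iff by blast
qed

text \<open>Fejer-type argument: the merit function of a KKT point bounds the iterates, so they have a
  cluster point, which is itself a KKT point. The merit function of the cluster point decreases
  and tends to zero along a subsequence, hence tends to zero.\<close>

lemma iterates_converge:
  assumes "p \<in> \<Omega>"
  obtains ubar where "ubar \<in> \<Omega>" "u \<longlonglongrightarrow> ubar"
proof -
  obtain l where l: "l > 0" "\<And>v. l * (norm v)\<^sup>2 \<le> v \<bullet> M v"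
    using psd_definite_coercive[OF M_psd M_definite] by blast
  have le: "l * (norm (u (Suc k) - q))\<^sup>2 \<le> merit q k" for q k
    using l(2)[of "u (Suc k) - q"] psd_nonneg[OF T, of "z (Suc k) - z k"] by (simp add: merit_def)
  have close: "norm (u (Suc k) - q) \<le> sqrt (inverse l * merit q k)" for q k
    using le[of k q] l(1) by (intro real_le_rsqrt) (simp add: field_simps)
  have "norm (u (Suc k) - p) \<le> sqrt (inverse l * merit p 0)" for k
  proof -
    have "merit p k \<le> merit p 0" using merit_decseq[OF assms] by (simp add: decseq_def)
    then have "sqrt (inverse l * merit p k) \<le> sqrt (inverse l * merit p 0)" using l(1) by simp
    with close[of k p] show ?thesis by (rule order_trans)
  qed
  then have "\<forall>k. u (Suc k) \<in> cball p (sqrt (inverse l * merit p 0))"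
    by (simp add: dist_norm norm_minus_commute)
  then have "bounded (range (\<lambda>k. u (Suc k)))"
    by (intro bounded_subset[OF bounded_cball[of p "sqrt (inverse l * merit p 0)"]]) blast
  from bounded_imp_convergent_subsequence[OF this]
  obtain q f where f: "strict_mono f" and q: "(\<lambda>n. u (Suc (f n))) \<longlonglongrightarrow> q"
    unfolding comp_def by metis
  have q\<Omega>: "q \<in> \<Omega>" using cluster_point_kkt[OF assms f] q by (cases q) auto
  obtain L where L: "merit q \<longlonglongrightarrow> L" using merit_converges[OF q\<Omega>] .
  have "bounded_linear M" using psd_linear[OF M_psd] by (simp add: linear_conv_bounded_linear)
  then have "(\<lambda>n. (u (Suc (f n)) - q) \<bullet> M (u (Suc (f n)) - q)) \<longlonglongrightarrow> (q - q) \<bullet> M (q - q)"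
    by (intro tendsto_intros bounded_linear.tendsto[of M] q)
  moreover have "(\<lambda>n. (z (Suc (f n)) - z (f n)) \<bullet> T (z (Suc (f n)) - z (f n))) \<longlonglongrightarrow> 0"
    by (rule tendsto_sandwich[OF _ _ tendsto_const LIMSEQ_subseq_LIMSEQ[OF gap_tendsto_0[OF assms] f]])
       (simp_all only: comp_def psd_nonneg[OF T] gap_ge(2) eventually_True)
  ultimately have "(\<lambda>n. merit q (f n)) \<longlonglongrightarrow> (q - q) \<bullet> M (q - q) + 0"
    unfolding merit_def by (rule tendsto_add)
  moreover have "(\<lambda>n. merit q (f n)) \<longlonglongrightarrow> L"
    using LIMSEQ_subseq_LIMSEQ[OF L f] by (simp add: comp_def)
  ultimately have "L = 0" using LIMSEQ_unique by fastforce
  then have "(\<lambda>k. sqrt (inverse l * merit q k)) \<longlonglongrightarrow> sqrt (inverse l * 0)"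
    using L by (intro tendsto_intros) simp
  then have lim: "(\<lambda>k. sqrt (inverse l * merit q k)) \<longlonglongrightarrow> 0" by simp
  have "(\<lambda>k. u (Suc k) - q) \<longlonglongrightarrow> 0"
    by (rule Lim_null_comparison[OF _ lim]) (simp only: close eventually_True)
  then have "(\<lambda>k. u (Suc k)) \<longlonglongrightarrow> q" by (simp add: Lim_null[symmetric])
  then have "u \<longlonglongrightarrow> q" by (simp only: filterlim_sequentially_Suc)
  with q\<Omega> show thesis by (rule that)
qed

end

section \<open>The linear rate\<close>

text \<open>The finitely many indices before \<open>\<mu>\<close> becomes valid have individual ratios below \<open>1\<close>; the
  largest of them and \<open>\<mu>\<close> serves for all.\<close>

lemma uniform_contraction:
  fixes D :: "nat \<Rightarrow> real"
  assumes nonneg: "\<And>k. 0 \<le> D k"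
    and strict: "\<And>k. D k \<noteq> 0 \<Longrightarrow> D (Suc k) < D k"
    and zero: "\<And>k. D k = 0 \<Longrightarrow> D (Suc k) = 0"
    and ev: "\<forall>\<^sub>F k in sequentially. D (Suc k) \<le> \<mu> * D k" and "\<mu> < 1"
  shows "\<exists>\<rho>\<in>{\<mu>..<1}. \<forall>k. D (Suc k) \<le> \<rho> * D k"
proof -
  obtain N where N: "\<And>k. k \<ge> N \<Longrightarrow> D (Suc k) \<le> \<mu> * D k"
    using ev unfolding eventually_sequentially by blast
  have "\<exists>\<rho>\<in>{\<mu>..<1}. \<forall>k<n. D (Suc k) \<le> \<rho> * D k" for n
  proof (induction n)
    case 0
    show ?case using \<open>\<mu> < 1\<close> by auto
  next
    case (Suc n)
    then obtain \<rho> where \<rho>: "\<rho> \<in> {\<mu>..<1}" "\<And>k. k < n \<Longrightarrow> D (Suc k) \<le> \<rho> * D k" by blast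
    obtain q where q: "q < 1" "D (Suc n) \<le> q * D n"
    proof (cases "D n = 0")
      case True then show thesis using that[of 0] zero[of n] by simp
    next
      case False
      then have "D n > 0" using nonneg[of n] by simp
      then show thesis using that[of "D (Suc n) / D n"] strict[OF False] by simp
    qed
    have le: "D (Suc k) \<le> max \<rho> q * D k" if "k < Suc n" for k
    proof (cases "k = n")
      case True
      then show ?thesis using q(2) mult_right_mono[of q "max \<rho> q", OF _ nonneg[of n]] by simp
    next
      case False
      then show ?thesis
        using \<rho>(2)[of k] that mult_right_mono[of \<rho> "max \<rho> q", OF _ nonneg[of k]] by simp
    qed
    have "max \<rho> q \<in> {\<mu>..<1}" using \<rho>(1) q(1) by auto
    then show ?case using le by blast
  qed
  then obtain \<rho> where \<rho>: "\<rho> \<in> {\<mu>..<1}" "\<And>k. k < N \<Longrightarrow> D (Suc k) \<le> \<rho> * D k" by blast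
  have "D (Suc k) \<le> \<rho> * D k" for k
  proof (cases "k < N")
    case False
    then have "D (Suc k) \<le> \<mu> * D k" by (intro N) simp
    also have "\<dots> \<le> \<rho> * D k" using \<rho>(1) nonneg[of k] by (intro mult_right_mono) auto
    finally show ?thesis .
  qed (rule \<rho>(2))
  with \<rho>(1) show ?thesis by blast
qed

context spadmm begin

text \<open>Indexed so that \<open>energy k\<close> belongs to the iterate \<open>u\<^sup>k\<^sup>+\<^sup>1\<close>: the descent inequality compares
  steps that come from subproblems, and there is none before \<open>u\<^sup>0\<close>.\<close>

definition "energy k = (wdist M (u (Suc k)) \<Omega>)\<^sup>2 + (z (Suc k) - z k) \<bullet> T (z (Suc k) - z k)"

lemma energy_nonneg: "0 \<le> energy k"
  by (simp add: energy_def psd_nonneg T)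

text \<open>The decrease \<open>gap\<close> does not depend on the KKT point, so the infimum over \<open>\<Omega>\<close> may be
  taken in the descent inequality.\<close>

lemma energy_descent:
  assumes "\<Omega> \<noteq> {}"
  shows "energy (Suc k) + gap (Suc k) \<le> energy k"
proof -
  have "(wdist M (u (Suc (Suc k))) \<Omega>)\<^sup>2 + (z (Suc (Suc k)) - z (Suc k)) \<bullet> T (z (Suc (Suc k)) - z (Suc k))
      + gap (Suc k) - (z (Suc k) - z k) \<bullet> T (z (Suc k) - z k) \<le> (wdist M (u (Suc k)) \<Omega>)\<^sup>2"
  proof (rule le_wdist_squared[OF M_psd assms])
    fix p assume "p \<in> \<Omega>"
    with descent[of p k] wdist_squared_le[OF M_psd, of p \<Omega> "u (Suc (Suc k))"]
    show "(wdist M (u (Suc (Suc k))) \<Omega>)\<^sup>2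
        + (z (Suc (Suc k)) - z (Suc k)) \<bullet> T (z (Suc (Suc k)) - z (Suc k))
        + gap (Suc k) - (z (Suc k) - z k) \<bullet> T (z (Suc k) - z k) \<le> (u (Suc k) - p) \<bullet> M (u (Suc k) - p)"
      unfolding merit_def by linarith
  qed
  then show ?thesis by (simp add: energy_def)
qed

text \<open>If the gap vanishes, all perturbations of the KKT inclusions vanish, so the new iterate is a KKT
  point.\<close>

lemma energy_eq_0:
  assumes "gap k = 0"
  shows "energy k = 0"
proof -
  have "progress k \<le> 0" using gap_ge(1)[of k] assms m_pos by (simp add: mult_le_0_iff)
  moreover have "0 \<le> progress k" using progress_parts[of k] by (simp add: progress_def)
  ultimately have "progress k = 0" by simp
  then have "res (Suc k) = 0" "Bs (z (Suc k) - z k) = 0" "S (y (Suc k) - y k) = 0" "T (z (Suc k) - z k) = 0"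
    using norm_steps_le_progress[of k] by simp_all
  with y_subgradient[of k] z_subgradient[of k]
  have "u (Suc k) \<in> \<Omega>" by (simp add: u_def kkt_iff) (simp add: res_def)
  then have "(wdist M (u (Suc k)) \<Omega>)\<^sup>2 \<le> 0"
    using wdist_squared_le[OF M_psd, of "u (Suc k)" \<Omega> "u (Suc k)"] by simp
  then show ?thesis using \<open>T (z (Suc k) - z k) = 0\<close> by (simp add: energy_def)
qed

lemma energy_strict:
  assumes "\<Omega> \<noteq> {}" "energy k \<noteq> 0"
  shows "energy (Suc k) < energy k"
proof (cases "gap (Suc k) = 0")
  case True
  then show ?thesis using energy_eq_0 energy_nonneg[of k] assms(2) by simp
next
  case False
  then show ?thesis using energy_descent[OF assms(1), of k] gap_ge(3)[of "Suc k"] by simp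
qed

lemma kappa_pos: "0 < kappa \<sigma> \<tau> S T A B"
proof -
  have "0 \<le> lambda_max (A \<circ> As)" "0 \<le> lambda_max (B \<circ> Bs)"
    using lambda_max_nonneg psd_gram A B by auto
  then have "inverse \<sigma> \<le> 3 * (1 - \<tau>)\<^sup>2 * \<sigma> * lambda_max (A \<circ> As)
      + 2 * (1 - \<tau>)\<^sup>2 * \<sigma> * lambda_max (B \<circ> Bs) + inverse \<sigma>"
    using \<sigma> by simp
  also have "\<dots> \<le> kappa \<sigma> \<tau> S T A B" by (simp add: kappa_def Let_def)
  finally show ?thesis using \<sigma> by (meson inverse_positive_iff_positive less_le_trans)
qed

lemma lambda_max_M_pos: "0 < lambda_max M"
proof -
  obtain v :: "'y \<times> 'z \<times> 'x" where v: "v \<in> Basis" using nonempty_Basis by blast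
  then have "v \<bullet> M v \<noteq> 0" using M_definite[of v] nonzero_Basis by blast
  then have "0 < v \<bullet> M v" using psd_nonneg[OF M_psd, of v] by simp
  also have "\<dots> \<le> lambda_max M * (norm v)\<^sup>2"
    using M_psd unfolding psd_def by (intro quadratic_form_le_lambda_max) blast
  finally show ?thesis using v by simp
qed

text \<open>The gap dominates both \<open>\<kappa>\<^sub>4 dist\<^sub>M\<^sup>2\<close> (error bound) and the \<open>T\<close>-seminorm of the last step;
  weighting the two bounds by \<open>1\<close> and \<open>\<kappa>\<^sub>4\<close> gives \<open>(1 + \<kappa>\<^sub>4) gap \<ge> \<kappa>\<^sub>4 energy\<close>.\<close>

lemma energy_contraction:
  assumes \<Omega>: "\<Omega> \<noteq> {}" and \<eta>: "\<eta> > 0"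
    and eb: "infdist (u (Suc (Suc k))) \<Omega> \<le> \<eta> * norm (kkt_map \<theta> \<phi> dg dh A B c (u (Suc (Suc k))))"
    and k4: "k4 = m * inverse (\<eta>\<^sup>2 * kappa \<sigma> \<tau> S T A B * lambda_max M)"
  shows "energy (Suc k) \<le> inverse (1 + 2 * k4) * (1 + k4) * energy k"
proof -
  let ?K = "\<eta>\<^sup>2 * kappa \<sigma> \<tau> S T A B * lambda_max M" and ?d = "(wdist M (u (Suc (Suc k))) \<Omega>)\<^sup>2"
  have K: "0 < ?K" using \<eta> kappa_pos lambda_max_M_pos by simp
  have k4_pos: "0 < k4" unfolding k4 by (rule mult_pos_pos[OF m_pos positive_imp_inverse_positive[OF K]])
  have "?d \<le> lambda_max M * (infdist (u (Suc (Suc k))) \<Omega>)\<^sup>2"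
    by (rule wdist_squared_le_lambda_max[OF M_psd \<Omega>])
  also have "\<dots> \<le> lambda_max M * (\<eta> * norm (kkt_map \<theta> \<phi> dg dh A B c (u (Suc (Suc k)))))\<^sup>2"
    using eb lambda_max_M_pos by (intro mult_left_mono power_mono infdist_nonneg) auto
  also have "\<dots> = lambda_max M * \<eta>\<^sup>2 * (norm (kkt_map \<theta> \<phi> dg dh A B c (u (Suc (Suc k)))))\<^sup>2"
    by (simp add: power_mult_distrib)
  also have "\<dots> \<le> lambda_max M * \<eta>\<^sup>2 * (kappa \<sigma> \<tau> S T A B * progress (Suc k))"
    using lambda_max_M_pos by (intro mult_left_mono residual_bound) auto
  finally have "?d \<le> ?K * progress (Suc k)" by (simp add: algebra_simps)
  then have "k4 * ?d \<le> k4 * (?K * progress (Suc k))" using k4_pos by simp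
  also have "\<dots> = m * progress (Suc k)"
  proof -
    have "m * inverse C * (C * P) = m * P" if "C > 0" for C P :: real
      using that by simp
    from this[OF K] show ?thesis unfolding k4 .
  qed
  also have "\<dots> \<le> gap (Suc k)" by (rule gap_ge(1))
  finally have 1: "k4 * ?d \<le> gap (Suc k)" .
  have "k4 * ((z (Suc (Suc k)) - z (Suc k)) \<bullet> T (z (Suc (Suc k)) - z (Suc k))) \<le> k4 * gap (Suc k)"
    using gap_ge(2)[of "Suc k"] k4_pos by simp
  with 1 have "k4 * energy (Suc k) \<le> gap (Suc k) + k4 * gap (Suc k)"
    unfolding energy_def distrib_left by linarith
  also have "\<dots> = (1 + k4) * gap (Suc k)" by (simp add: algebra_simps)
  also have "\<dots> \<le> (1 + k4) * (energy k - energy (Suc k))"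
    using energy_descent[OF \<Omega>, of k] k4_pos by (intro mult_left_mono) auto
  finally have "(1 + 2 * k4) * energy (Suc k) \<le> (1 + k4) * energy k" by (simp add: algebra_simps)
  then show ?thesis using k4_pos by (simp add: field_simps)
qed

lemma linear_rate:
  assumes ubar: "ubar \<in> \<Omega>" "u \<longlonglongrightarrow> ubar" and \<eta>: "\<eta> > 0" and \<delta>: "\<delta> > 0"
    and eb: "\<And>v. norm (v - ubar) \<le> \<delta> \<Longrightarrow> infdist v \<Omega> \<le> \<eta> * norm (kkt_map \<theta> \<phi> dg dh A B c v)"
    and k4: "k4 = m * inverse (\<eta>\<^sup>2 * kappa \<sigma> \<tau> S T A B * lambda_max M)"
    and \<mu>: "\<mu> = inverse (1 + 2 * k4) * (1 + k4)"
  shows "0 < k4" "\<mu> < 1"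
    "\<forall>\<^sub>F k in sequentially. energy (Suc k) \<le> \<mu> * energy k"
    "\<exists>\<rho>\<in>{\<mu>..<1}. \<forall>k. energy (Suc k) \<le> \<rho> * energy k"
proof -
  have ne: "\<Omega> \<noteq> {}" using ubar by blast
  show k4_pos: "0 < k4" unfolding k4 using \<eta> m_pos kappa_pos lambda_max_M_pos by simp
  then show \<mu>1: "\<mu> < 1" unfolding \<mu> by (simp add: field_simps)
  have "(\<lambda>k. u (Suc (Suc k))) \<longlonglongrightarrow> ubar" using ubar(2) by (intro LIMSEQ_Suc)
  then have "\<forall>\<^sub>F k in sequentially. dist (u (Suc (Suc k))) ubar < \<delta>" using \<delta> by (rule tendstoD)
  then show ev: "\<forall>\<^sub>F k in sequentially. energy (Suc k) \<le> \<mu> * energy k"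
  proof eventually_elim
    case (elim k)
    then have "infdist (u (Suc (Suc k))) \<Omega> \<le> \<eta> * norm (kkt_map \<theta> \<phi> dg dh A B c (u (Suc (Suc k))))"
      by (intro eb) (simp add: dist_norm)
    from energy_contraction[OF ne \<eta> this k4] show ?case by (simp add: \<mu>)
  qed
  show "\<exists>\<rho>\<in>{\<mu>..<1}. \<forall>k. energy (Suc k) \<le> \<rho> * energy k"
  proof (rule uniform_contraction[OF energy_nonneg energy_strict[OF ne] _ ev \<mu>1])
    fix k assume "energy k = 0"
    then show "energy (Suc k) = 0"
      using energy_descent[OF ne, of k] gap_ge(3)[of "Suc k"] energy_nonneg[of "Suc k"] by simp
  qed
qed

end

theorem theorem3p2:
  fixes \<theta> :: "'y::euclidean_space \<Rightarrow> ereal" and \<phi> :: "'z::euclidean_space \<Rightarrow> ereal"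
    and g :: "'y \<Rightarrow> real" and h :: "'z \<Rightarrow> real"
    and dg :: "'y \<Rightarrow> 'y" and dh :: "'z \<Rightarrow> 'z"
    and A :: "'x::euclidean_space \<Rightarrow> 'y" and B :: "'x \<Rightarrow> 'z" and c :: 'x
    and \<sigma> \<tau> :: real
    and S \<Sigma>\<^sub>\<theta> :: "'y \<Rightarrow> 'y" and T \<Sigma>\<^sub>\<phi> :: "'z \<Rightarrow> 'z"
    and y :: "nat \<Rightarrow> 'y" and z :: "nat \<Rightarrow> 'z" and x :: "nat \<Rightarrow> 'x"
  defines "\<Omega> \<equiv> kkt_set \<theta> \<phi> dg dh A B c"
    and "R \<equiv> kkt_map \<theta> \<phi> dg dh A B c"
    and "M \<equiv> M_op \<sigma> \<tau> S T \<Sigma>\<^sub>\<theta> \<Sigma>\<^sub>\<phi> A B"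
    and "u \<equiv> \<lambda>k. (y k, z k, x k)"
    and "\<kappa>4 \<equiv> \<lambda>\<eta>. min \<tau> (4 * t_tau \<tau>)
               * inverse (\<eta>\<^sup>2 * kappa \<sigma> \<tau> S T A B * lambda_max (M_op \<sigma> \<tau> S T \<Sigma>\<^sub>\<theta> \<Sigma>\<^sub>\<phi> A B))"
  assumes "proper_closed_convex \<theta>" and "proper_closed_convex \<phi>"
    and "convex_on UNIV g" and "\<And>v. GDERIV g v :> dg v" and "continuous_on UNIV dg"
    and "convex_on UNIV h" and "\<And>w. GDERIV h w :> dh w" and "continuous_on UNIV dh"
    and "linear A" and "linear B"
    and "\<sigma> > 0"
    and "0 < \<tau>" and "\<tau> < (1 + sqrt 5) / 2"
    and "psd S" and "psd T"
    and "psd \<Sigma>\<^sub>\<theta>" and "psd \<Sigma>\<^sub>\<phi>"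
    and "\<And>v v' \<xi> \<xi>'. \<xi> \<in> subdifferential (\<lambda>w. \<theta> w + ereal (g w)) v \<Longrightarrow>
           \<xi>' \<in> subdifferential (\<lambda>w. \<theta> w + ereal (g w)) v' \<Longrightarrow>
           (\<xi>' - \<xi>) \<bullet> (v' - v) \<ge> (wnorm \<Sigma>\<^sub>\<theta> (v' - v))\<^sup>2"
    and "\<And>w w' \<zeta> \<zeta>'. \<zeta> \<in> subdifferential (\<lambda>v. \<phi> v + ereal (h v)) w \<Longrightarrow>
           \<zeta>' \<in> subdifferential (\<lambda>v. \<phi> v + ereal (h v)) w' \<Longrightarrow>
           (\<zeta>' - \<zeta>) \<bullet> (w' - w) \<ge> (wnorm \<Sigma>\<^sub>\<phi> (w' - w))\<^sup>2"
    and "\<Omega> \<noteq> {}"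
    and "\<forall>ubar\<in>\<Omega>. \<exists>\<delta>>0. \<exists>\<eta>>0. \<forall>v. norm (v - ubar) \<le> \<delta> \<longrightarrow> infdist v \<Omega> \<le> \<eta> * norm (R v)"
    and "pos_def (\<lambda>v. \<Sigma>\<^sub>\<theta> v + S v + \<sigma> *\<^sub>R A (adjoint A v))"
    and "pos_def (\<lambda>w. \<Sigma>\<^sub>\<phi> w + T w + \<sigma> *\<^sub>R B (adjoint B w))"
    and "sPADMM_sequence \<sigma> \<tau> S T \<theta> \<phi> g h A B c y z x"
  shows "\<exists>ubar\<in>\<Omega>. u \<longlonglongrightarrow> ubar \<and>
    (\<forall>\<eta>>0. (\<exists>\<delta>>0. \<forall>v. norm (v - ubar) \<le> \<delta> \<longrightarrow> infdist v \<Omega> \<le> \<eta> * norm (R v)) \<longrightarrow>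
      (let \<mu> = inverse (1 + 2 * \<kappa>4 \<eta>) * (1 + \<kappa>4 \<eta>) in
        \<kappa>4 \<eta> > 0 \<and> \<mu> < 1 \<and>
        (\<forall>\<^sub>F k in sequentially.
           (wdist M (u (k + 1)) \<Omega>)\<^sup>2 + (wnorm T (z (k + 1) - z k))\<^sup>2
             \<le> \<mu> * ((wdist M (u k) \<Omega>)\<^sup>2 + (wnorm T (z k - z (k - 1)))\<^sup>2)) \<and>
        (\<exists>\<rho>\<in>{\<mu>..<1}. \<forall>k\<ge>1.
           (wdist M (u (k + 1)) \<Omega>)\<^sup>2 + (wnorm T (z (k + 1) - z k))\<^sup>2
             \<le> \<rho> * ((wdist M (u k) \<Omega>)\<^sup>2 + (wnorm T (z k - z (k - 1)))\<^sup>2))))"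
proof -
  interpret s: spadmm \<theta> \<phi> g h dg dh A B c \<sigma> \<tau> S \<Sigma>\<^sub>\<theta> T \<Sigma>\<^sub>\<phi> y z x
    by (rule spadmm.intro) (fact assms)+
  have \<Omega>: "s.\<Omega> = \<Omega>" and M: "s.M = M" and u: "s.u = u"
    by (simp_all add: s.\<Omega>_def \<Omega>_def s.M_def M_def s.u_def u_def fun_eq_iff)
  have \<kappa>4: "\<kappa>4 \<eta> = s.m * inverse (\<eta>\<^sup>2 * kappa \<sigma> \<tau> S T A B * lambda_max s.M)" for \<eta>
    by (simp add: \<kappa>4_def s.m_def s.M_def)
  have energy: "s.energy k = (wdist M (u (Suc k)) \<Omega>)\<^sup>2 + (wnorm T (z (Suc k) - z k))\<^sup>2" for k
    by (simp add: s.energy_def \<Omega> M u wnorm_squared[OF s.T])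
  obtain p where "p \<in> \<Omega>" using \<open>\<Omega> \<noteq> {}\<close> by blast
  then obtain ubar where ubar: "ubar \<in> \<Omega>" "u \<longlonglongrightarrow> ubar"
    using s.iterates_converge[of p] unfolding \<Omega> u by blast
  show ?thesis
  proof (intro bexI[OF _ ubar(1)] conjI[OF ubar(2)] allI impI)
    fix \<eta> :: real
    assume \<eta>: "\<eta> > 0" and "\<exists>\<delta>>0. \<forall>v. norm (v - ubar) \<le> \<delta> \<longrightarrow> infdist v \<Omega> \<le> \<eta> * norm (R v)"
    then obtain \<delta> where \<delta>: "\<delta> > 0"
      and eb: "\<And>v. norm (v - ubar) \<le> \<delta> \<Longrightarrow> infdist v s.\<Omega> \<le> \<eta> * norm (kkt_map \<theta> \<phi> dg dh A B c v)"
      unfolding R_def \<Omega> by blast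
    define \<mu> where "\<mu> = inverse (1 + 2 * \<kappa>4 \<eta>) * (1 + \<kappa>4 \<eta>)"
    \<comment> \<open>At index \<open>k \<ge> 1\<close> the bracket on the right is \<open>s.energy (k - 1)\<close>; at \<open>k = 0\<close> the truncated
      \<open>k - 1\<close> makes it a different quantity, about which nothing is claimed.\<close>
    define P where "P \<rho> k \<longleftrightarrow> (wdist M (u (k + 1)) \<Omega>)\<^sup>2 + (wnorm T (z (k + 1) - z k))\<^sup>2
        \<le> \<rho> * ((wdist M (u k) \<Omega>)\<^sup>2 + (wnorm T (z k - z (k - 1)))\<^sup>2)" for \<rho> k
    have P_Suc: "P \<rho> (Suc k) \<longleftrightarrow> s.energy (Suc k) \<le> \<rho> * s.energy k" for \<rho> k
      by (simp add: P_def energy)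
    note rate = s.linear_rate[OF ubar[folded \<Omega> u] \<eta> \<delta> eb \<kappa>4 \<mu>_def]
    have "\<forall>\<^sub>F k in sequentially. P \<mu> k"
      using rate(3) unfolding P_Suc[symmetric] by (simp only: eventually_sequentially_Suc)
    moreover obtain \<rho> where \<rho>: "\<rho> \<in> {\<mu>..<1}" "\<And>k. P \<rho> (Suc k)"
      using rate(4) unfolding P_Suc[symmetric] by blast
    moreover have "P \<rho> k" if "k \<ge> 1" for k
      using \<rho>(2)[of "k - 1"] that by simp
    ultimately show "let \<mu> = inverse (1 + 2 * \<kappa>4 \<eta>) * (1 + \<kappa>4 \<eta>) in
        \<kappa>4 \<eta> > 0 \<and> \<mu> < 1 \<and>
        (\<forall>\<^sub>F k in sequentially.
           (wdist M (u (k + 1)) \<Omega>)\<^sup>2 + (wnorm T (z (k + 1) - z k))\<^sup>2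
             \<le> \<mu> * ((wdist M (u k) \<Omega>)\<^sup>2 + (wnorm T (z k - z (k - 1)))\<^sup>2)) \<and>
        (\<exists>\<rho>\<in>{\<mu>..<1}. \<forall>k\<ge>1.
           (wdist M (u (k + 1)) \<Omega>)\<^sup>2 + (wnorm T (z (k + 1) - z k))\<^sup>2
             \<le> \<rho> * ((wdist M (u k) \<Omega>)\<^sup>2 + (wnorm T (z k - z (k - 1)))\<^sup>2))"
      unfolding Let_def P_def[symmetric] \<mu>_def[symmetric] using rate(1,2) by blast
  qed
qed

end
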